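(* Let $1<p<\infty$, let $U_n:L^1(0,1)\to L^\infty(0,1)$, $n=1,2,\ldots$, be a sequence of bounded linear operators satisfying properties (A), (B), (C) and (D* ) (listed in the context), and let $U\subset[0,1)$ be an everywhere dense open set. Then for every $f\in L^1(0,1)$ there is a function $g\in L^1(0,1)$ such that $\{x: f(x)\neq g(x)\}\subset U$ and $$U_n g(x)\to g(x)\quad\text{for almost every } x .$$
   Context: $|E|$ denotes Lebesgue measure, $\mathbf 1_E$ the indicator function of $E$, $\|\cdot\|_p$ the norm of $L^p(0,1)$. Intervals are of the form $[a,b)\subset[0,1)$. A finite-interval set is a union of finitely many intervals. Weak convergence: $f_n\overset{w}{\to}f$ for $f_n,f\in L^1(0,1)$ means $\int_0^1 f_n g\to\int_0^1 fg$ for every $g\in L^\infty(0,1)$. A bounded linear operator $T:L^1(0,1)\to L^1(0,1)$ is called compact if $\|T(f_n)-T(f)\|_1\to0$ whenever $f_n\overset{w}{\to}f$. (An operator $L^1(0,1)\to L^\infty(0,1)$ is regarded as an operator into $L^1(0,1)$.) A countable family $\mathcal I$ of intervals is called a basis if 1) $[0,1)\in\mathcal I$; 2) for any $\Delta=[a,b)\in\mathcal I$ there are infinitely many integers $l>0$ such that $[a+|\Delta|(j-1)/l,\,a+|\Delta|j/l)\in\mathcal I$ for all $j=1,\ldots,l$. Put $U^*f(x)=\sup_n|U_nf(x)|$. The properties are: (A) each $U_n$ is a compact operator; (B) $\|U_n(f)-f\|_p\to0$ as $n\to\infty$ for every $f\in L^p(0,1)$; (C) $U_n(\mathbf 1_G)$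 converges almost everywhere for any interval $G$; (D* ) there is a constant $\beta>0$ depending only on the sequence $(U_n)$ such that for every $0<\varepsilon<1$ and every everywhere dense open set $U$ there is a sequence of finite-interval sets $G_l\subset U$, $l=1,2,\ldots$, with $|G_l|\le\varepsilon$ for all $l$ and $|G_l|^{-1}\mathbf 1_{G_l}\overset{w}{\to}\mathbf 1_{[0,1)}$ as $l\to\infty$, and there is a basis $\mathcal I$ such that for any $\Delta\in\mathcal I$ and $\lambda>0$ $$\lambda\cdot|\{U^*(\mathbf 1_{G_l\cap\Delta})>\lambda\}|\le\beta\,|G_l\cap\Delta|,\quad l=1,2,\ldots.$$ *)

theory Defs
  imports "HOL-Probability.Essential_Supremum"
begin

text \<open>
  Elements of the Lebesgue spaces over $(0,1)$ are represented by functions on the whole real line.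
  Their values outside $[0,1)$ are irrelevant, and operators act on representatives, so linearity
  and well-definedness of operators are required almost everywhere on $[0,1)$.
\<close>

abbreviation unit_leb :: "real measure" where
  "unit_leb \<equiv> lebesgue_on {0..<1}"

definition Lp :: "real \<Rightarrow> (real \<Rightarrow> real) set" where
  "Lp p = {f. f \<in> borel_measurable unit_leb \<and> integrable unit_leb (\<lambda>x. \<bar>f x\<bar> powr p)}"

definition Lp_norm :: "real \<Rightarrow> (real \<Rightarrow> real) \<Rightarrow> real" where
  "Lp_norm p f = (LINT x|unit_leb. \<bar>f x\<bar> powr p) powr (1 / p)"

definition Linf :: "(real \<Rightarrow> real) set" where
  "Linf = {f. f \<in> borel_measurable unit_leb \<and> esssup unit_leb (\<lambda>x. ereal \<bar>f x\<bar>) < \<infinity>}"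

definition Linf_norm :: "(real \<Rightarrow> real) \<Rightarrow> real" where
  "Linf_norm f = real_of_ereal (esssup unit_leb (\<lambda>x. ereal \<bar>f x\<bar>))"

text \<open>Bounded linear operators from $L^1(0,1)$ to the space \<open>Y\<close> with norm \<open>N\<close>.\<close>

definition bounded_operator_into ::
  "(real \<Rightarrow> real) set \<Rightarrow> ((real \<Rightarrow> real) \<Rightarrow> real) \<Rightarrow> ((real \<Rightarrow> real) \<Rightarrow> real \<Rightarrow> real) \<Rightarrow> bool" where
  "bounded_operator_into Y N T \<longleftrightarrow>
    (\<forall>f\<in>Lp 1. T f \<in> Y) \<and>
    (\<forall>f\<in>Lp 1. \<forall>g\<in>Lp 1. (AE x in unit_leb. f x = g x) \<longrightarrow> (AE x in unit_leb. T f x = T g x)) \<and>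
    (\<forall>f\<in>Lp 1. \<forall>g\<in>Lp 1. AE x in unit_leb. T (\<lambda>y. f y + g y) x = T f x + T g x) \<and>
    (\<forall>c. \<forall>f\<in>Lp 1. AE x in unit_leb. T (\<lambda>y. c * f y) x = c * T f x) \<and>
    (\<exists>C. \<forall>f\<in>Lp 1. N (T f) \<le> C * Lp_norm 1 f)"

definition weakly_converges :: "(nat \<Rightarrow> real \<Rightarrow> real) \<Rightarrow> (real \<Rightarrow> real) \<Rightarrow> bool" where
  "weakly_converges F f \<longleftrightarrow>
    (\<forall>n. F n \<in> Lp 1) \<and> f \<in> Lp 1 \<and>
    (\<forall>g\<in>Linf. (\<lambda>n. LINT x|unit_leb. F n x * g x) \<longlonglongrightarrow> (LINT x|unit_leb. f x * g x))"

definition compact_operator :: "((real \<Rightarrow> real) \<Rightarrow> real \<Rightarrow> real) \<Rightarrow> bool" where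
  "compact_operator T \<longleftrightarrow>
    bounded_operator_into (Lp 1) (Lp_norm 1) T \<and>
    (\<forall>F f. weakly_converges F f \<longrightarrow> (\<lambda>n. Lp_norm 1 (\<lambda>x. T (F n) x - T f x)) \<longlonglongrightarrow> 0)"

definition unit_interval :: "real set \<Rightarrow> bool" where
  "unit_interval S \<longleftrightarrow> (\<exists>a b. 0 \<le> a \<and> a < b \<and> b \<le> 1 \<and> S = {a..<b})"

definition finite_interval_set :: "real set \<Rightarrow> bool" where
  "finite_interval_set S \<longleftrightarrow> (\<exists>\<F>. finite \<F> \<and> (\<forall>J\<in>\<F>. unit_interval J) \<and> S = \<Union>\<F>)"

definition interval_basis :: "real set set \<Rightarrow> bool" where
  "interval_basis \<I> \<longleftrightarrow>
    countable \<I> \<and> (\<forall>J\<in>\<I>. unit_interval J) \<and> {0..<1} \<in> \<I> \<and>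
    (\<forall>a b. a < b \<and> {a..<b} \<in> \<I> \<longrightarrow>
      infinite {l::nat. l > 0 \<and>
        (\<forall>j\<in>{1..l}. {a + (b - a) * (real j - 1) / real l ..< a + (b - a) * real j / real l} \<in> \<I>)})"

definition dense_open :: "real set \<Rightarrow> bool" where
  "dense_open V \<longleftrightarrow> openin (top_of_set {0..<1}) V \<and> {0..<1} \<subseteq> closure V"

definition maximal_fn ::
  "(nat \<Rightarrow> (real \<Rightarrow> real) \<Rightarrow> real \<Rightarrow> real) \<Rightarrow> (real \<Rightarrow> real) \<Rightarrow> real \<Rightarrow> ereal" where
  "maximal_fn U f x = (SUP n. ereal \<bar>U n f x\<bar>)"

definition property_A :: "(nat \<Rightarrow> (real \<Rightarrow> real) \<Rightarrow> real \<Rightarrow> real) \<Rightarrow> bool" where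
  "property_A U \<longleftrightarrow> (\<forall>n. compact_operator (U n))"

definition property_B :: "real \<Rightarrow> (nat \<Rightarrow> (real \<Rightarrow> real) \<Rightarrow> real \<Rightarrow> real) \<Rightarrow> bool" where
  "property_B p U \<longleftrightarrow> (\<forall>f\<in>Lp p. (\<lambda>n. Lp_norm p (\<lambda>x. U n f x - f x)) \<longlonglongrightarrow> 0)"

definition property_C :: "(nat \<Rightarrow> (real \<Rightarrow> real) \<Rightarrow> real \<Rightarrow> real) \<Rightarrow> bool" where
  "property_C U \<longleftrightarrow>
    (\<forall>G. unit_interval G \<longrightarrow> (AE x in unit_leb. convergent (\<lambda>n. U n (indicat_real G) x)))"

text \<open>The requirement $|G_l| > 0$ makes $|G_l|^{-1}$ meaningful.\<close>

definition property_Dstar :: "(nat \<Rightarrow> (real \<Rightarrow> real) \<Rightarrow> real \<Rightarrow> real) \<Rightarrow> bool" where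
  "property_Dstar U \<longleftrightarrow>
    (\<exists>\<beta>>0. \<forall>\<epsilon> V. 0 < \<epsilon> \<and> \<epsilon> < 1 \<and> dense_open V \<longrightarrow>
      (\<exists>G :: nat \<Rightarrow> real set.
        (\<forall>l. finite_interval_set (G l) \<and> G l \<subseteq> V \<and>
             0 < measure lebesgue (G l) \<and> measure lebesgue (G l) \<le> \<epsilon>) \<and>
        weakly_converges (\<lambda>l x. inverse (measure lebesgue (G l)) * indicat_real (G l) x)
          (indicat_real {0..<1}) \<and>
        (\<exists>\<I>. interval_basis \<I> \<and>
          (\<forall>\<Delta>\<in>\<I>. \<forall>t>0. \<forall>l.
            t * measure lebesgue {x\<in>{0..<1}. maximal_fn U (indicat_real (G l \<inter> \<Delta>)) x > ereal t}
              \<le> \<beta> * measure lebesgue (G l \<inter> \<Delta>)))))"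

end

theory Submission imports Defs begin

text \<open>
  The proof is a gliding hump argument. Uniform partitions of $[0,1)$ into intervals of the basis
  give an expansion $f = \sum_k \varphi_k$ a.e. with $\varphi_k = c_k \mathbf 1_{\Delta_k}$ and
  $\sum_k \|\varphi_k\|_1 < \infty$. Put $\psi_k = -c_k |G_l|^{-1} \mathbf 1_{G_l \cap \Delta_k}$,
  which is supported in the dense open set, and $g = \sum_k (\varphi_k + \psi_k)$.
  As $l \to \infty$, $\varphi_k + \psi_k$ tends weakly to $0$, so by compactness $l = l_k$ can be
  chosen such that $U_n(\varphi_k + \psi_k)$ is negligible for $n < N_k$, where $N_k$ is so large that
  from $N_k$ on $U_n$ reproduces $W_k = \sum_{i<k} (\varphi_i + \psi_i) + \varphi_k$ up to $2^{-k}$ off a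
  set of measure $2^{-k}$. Hence for $N_k \le n < N_{k+1}$ the only other contribution
  to $U_n g - g$ is $U_n \psi_k$, and since (D*) bounds the weak $L^1$ norm of $U^* \psi_k$ by a
  multiple of $\|\varphi_k\|_1$, the Borel--Cantelli lemma gives $U^* \psi_k \to 0$ a.e.
\<close>

subsection \<open>Operators on the unit interval\<close>

text \<open>\<open>property_Dstar\<close> controls the maximal function only on indicators of
  \<open>G l \<inter> \<Delta>\<close> with \<Delta> in a basis that comes together with
  \<open>G\<close>; this is why f has to be expanded in indicators of basis intervals. The estimate
  is linear in the measure, so after scaling it is governed by the L^1 norm of \<psi>_k alone,
  however large |G_l|^{-1} may be, and summable L^1 norms are what Borel--Cantelli asks for. No
  maximal estimate is at hand for \<phi>_k or for whole partial sums. Hence, for N_k \<le> n <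
  N_{k+1}, the splitting of U_n g into U_n W_k, U_n \<psi>_k and the sum of U_n(\<phi>_i + \<psi>_i)
  over i > k: W_k is a finite combination of interval indicators, on which (B) and (C) give
  convergence; \<psi>_k falls under the weak-type bound; the tail is small by compactness. Moving
  U_n through the infinite series relies on boundedness into L^\<infinity>: L^1 convergence of the
  partial sums gives convergence of their images at almost every x, for all n at once.\<close>

lemma finite_measure_unit_leb: "finite_measure unit_leb"
  by (intro finite_measure_lebesgue_on bounded_set_imp_lmeasurable) auto

interpretation unit_leb: finite_measure unit_leb
  by (rule finite_measure_unit_leb)

lemma measure_unit_leb:
  assumes "A \<subseteq> {0..<1}" "A \<in> sets lebesgue"
  shows "A \<in> sets unit_leb" "measure unit_leb A = measure lebesgue A"
  using assms by (auto simp: sets_restrict_space_iff measure_restrict_space)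

lemma Lp_1_iff: "f \<in> Lp 1 \<longleftrightarrow> integrable unit_leb f"
  by (auto simp: Lp_def integrable_abs_iff)

lemma Lp_norm_1: "Lp_norm 1 f = (LINT x|unit_leb. \<bar>f x\<bar>)"
  by (simp add: Lp_norm_def powr_one)

lemma Linf_bounded:
  assumes "f \<in> Linf"
  shows "AE x in unit_leb. \<bar>f x\<bar> \<le> Linf_norm f"
  using esssup_AE[of "\<lambda>x. ereal \<bar>f x\<bar>" unit_leb]
proof eventually_elim
  case (elim x)
  \<comment> \<open>\<open>real_of_ereal\<close> sends \<infinity> to 0, so finiteness must be
    settled before the essential supremum can serve as a real bound.\<close>
  have "esssup unit_leb (\<lambda>x. ereal \<bar>f x\<bar>) \<noteq> \<infinity>"
    using assms by (auto simp: Linf_def)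
  then show ?case
    using elim unfolding Linf_norm_def
    by (cases "esssup unit_leb (\<lambda>x. ereal \<bar>f x\<bar>)") auto
qed

lemma bounded_in_Linf:
  assumes "f \<in> borel_measurable unit_leb" "AE x in unit_leb. \<bar>f x\<bar> \<le> B"
  shows "f \<in> Linf"
proof -
  have "esssup unit_leb (\<lambda>x. ereal \<bar>f x\<bar>) \<le> ereal B"
    using assms by (intro esssup_I) auto
  then show ?thesis
    using assms by (auto simp: Linf_def intro: le_less_trans)
qed

text \<open>By monotone convergence the integral of the sum of all \<open>\<bar>f i\<bar>\<close> is
  the sum of the integrals, hence finite, and a function with finite integral is finite almost
  everywhere.\<close>

lemma AE_summable_of_integrals:
  fixes f :: "nat \<Rightarrow> 'a \<Rightarrow> real"
  assumes int: "\<And>i. integrable M (f i)" and sum: "summable (\<lambda>i. LINT x|M. \<bar>f i x\<bar>)"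
  shows "AE x in M. summable (\<lambda>i. \<bar>f i x\<bar>)"
proof -
  have [measurable]: "f i \<in> borel_measurable M" for i
    using int by auto
  have "(\<integral>\<^sup>+x. (\<Sum>i. ennreal \<bar>f i x\<bar>) \<partial>M) = (\<Sum>i. \<integral>\<^sup>+x. ennreal \<bar>f i x\<bar> \<partial>M)"
    by (intro nn_integral_suminf) auto
  also have "\<dots> = (\<Sum>i. ennreal (LINT x|M. \<bar>f i x\<bar>))"
    using int by (intro suminf_cong nn_integral_eq_integral) auto
  also have "\<dots> \<noteq> \<infinity>"
    using sum by (simp add: ennreal_suminf_neq_top)
  finally have "AE x in M. (\<Sum>i. ennreal \<bar>f i x\<bar>) \<noteq> \<infinity>"
    by (intro nn_integral_PInf_AE) auto
  then show ?thesis
    by eventually_elim (auto intro: summable_suminf_not_top)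
qed

text \<open>Egorov-type argument: the exceptional sets decrease in N to a null set, so on a finite
  measure space their measures tend to 0. One \<open>e\<close> is both threshold and measure bound,
  so that \<open>e = (1 / 2) ^ k\<close> later gives errors tending to 0 off sets of summable
  measure.\<close>

lemma (in finite_measure) eventually_tail_exceptional_set_small:
  fixes F :: "nat \<Rightarrow> 'a \<Rightarrow> real"
  assumes [measurable]: "\<And>n. F n \<in> borel_measurable M"
    and lim: "AE x in M. (\<lambda>n. F n x) \<longlonglongrightarrow> 0" and "e > 0"
  shows "\<forall>\<^sub>F N in sequentially. measure M {x \<in> space M. \<exists>n\<ge>N. \<bar>F n x\<bar> > e} < e"
proof -
  define A where "A N = {x \<in> space M. \<exists>n\<ge>N. \<bar>F n x\<bar> > e}" for N
  have [measurable]: "A N \<in> sets M" for N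
    unfolding A_def by measurable
  have "(\<lambda>N. measure M (A N)) \<longlonglongrightarrow> measure M (\<Inter>N. A N)"
    by (intro finite_Lim_measure_decseq) (auto simp: A_def decseq_def intro: order_trans)
  moreover have "AE x in M. x \<notin> (\<Inter>N. A N)"
    using lim
  proof eventually_elim
    case (elim x)
    then obtain N where "\<forall>n\<ge>N. \<bar>F n x\<bar> < e"
      using \<open>e > 0\<close> by (auto simp: LIMSEQ_iff)
    then show ?case
      by (force simp: A_def)
  qed
  then have "measure M (\<Inter>N. A N) = 0"
    by (subst (asm) AE_iff_null_sets[symmetric]) (auto intro: measure_eq_0_null_sets)
  ultimately show ?thesis
    using order_tendstoD(2)[OF _ \<open>e > 0\<close>, of "\<lambda>N. measure M (A N)"] by (simp add: A_def)
qed

section \<open>Linearity and boundedness almost everywhere for operators on representatives\<close>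

lemma bounded_operatorD:
  assumes "bounded_operator_into Linf Linf_norm T"
  shows op_Linf: "integrable unit_leb f \<Longrightarrow> T f \<in> Linf"
    and op_measurable: "integrable unit_leb f \<Longrightarrow> T f \<in> borel_measurable unit_leb"
    and op_add: "integrable unit_leb f \<Longrightarrow> integrable unit_leb g \<Longrightarrow>
      AE x in unit_leb. T (\<lambda>y. f y + g y) x = T f x + T g x"
    and op_scale: "integrable unit_leb f \<Longrightarrow> AE x in unit_leb. T (\<lambda>y. c * f y) x = c * T f x"
  using assms by (auto simp: bounded_operator_into_def Lp_1_iff Linf_def)

lemma op_diff:
  assumes T: "bounded_operator_into Linf Linf_norm T"
    and f: "integrable unit_leb f" and g: "integrable unit_leb g"
  shows "AE x in unit_leb. T (\<lambda>y. f y - g y) x = T f x - T g x"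
  using op_add[OF T f integrable_minus[OF g]] op_scale[OF T g, of "-1"]
  by eventually_elim simp

text \<open>The essential supremum norm turns the operator bound into one at almost every point,
  with \<open>C\<close> common to all \<open>f\<close>. In this form L^1 convergence of a sequence
  passes to a.e. convergence of its images.\<close>

lemma op_bound:
  assumes T: "bounded_operator_into Linf Linf_norm T"
  shows "\<exists>C. \<forall>f. integrable unit_leb f \<longrightarrow>
    (AE x in unit_leb. \<bar>T f x\<bar> \<le> C * (LINT x|unit_leb. \<bar>f x\<bar>))"
proof -
  obtain C where C: "\<forall>f\<in>Lp 1. Linf_norm (T f) \<le> C * Lp_norm 1 f"
    using T by (auto simp: bounded_operator_into_def)
  have "AE x in unit_leb. \<bar>T f x\<bar> \<le> C * (LINT x|unit_leb. \<bar>f x\<bar>)" if "integrable unit_leb f" for f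
    using Linf_bounded[OF op_Linf[OF T that]]
    by eventually_elim (use C that in \<open>force simp: Lp_1_iff Lp_norm_1\<close>)
  then show ?thesis
    by blast
qed

lemma op_integrable:
  assumes T: "bounded_operator_into Linf Linf_norm T" and f: "integrable unit_leb f"
  shows "integrable unit_leb (T f)"
  using Linf_bounded[OF op_Linf[OF T f]] op_measurable[OF T f]
  by (intro unit_leb.integrable_const_bound[where B = "Linf_norm (T f)"]) auto

lemma compact_operator_null:
  assumes T: "bounded_operator_into Linf Linf_norm T" and "compact_operator T"
    and F: "weakly_converges F (\<lambda>_. 0)"
  shows "(\<lambda>l. LINT x|unit_leb. \<bar>T (F l) x\<bar>) \<longlonglongrightarrow> 0"
proof -
  have int: "integrable unit_leb (F l)" for l
    using F by (simp add: weakly_converges_def Lp_1_iff)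
  \<comment> \<open>An operator on representatives need not send 0 to 0 pointwise; homogeneity with
    the scalar 0 gives it almost everywhere.\<close>
  have T0: "AE x in unit_leb. T (\<lambda>_. 0) x = 0"
    using op_scale[OF T, of "\<lambda>_. 0" 0] by simp
  have "(LINT x|unit_leb. \<bar>T (F l) x - T (\<lambda>_. 0) x\<bar>) = (LINT x|unit_leb. \<bar>T (F l) x\<bar>)" for l
    using T0 op_measurable[OF T int] op_measurable[OF T, of "\<lambda>_. 0"]
    by (intro integral_cong_AE) auto
  moreover have "(\<lambda>l. Lp_norm 1 (\<lambda>x. T (F l) x - T (\<lambda>_. 0) x)) \<longlonglongrightarrow> 0"
    using assms by (auto simp: compact_operator_def)
  ultimately show ?thesis
    by (simp add: Lp_norm_1)
qed

text \<open>Integrability is built in because \<open>U n\<close> is additive and homogeneous on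
  \<open>Lp 1\<close> only; with it the class is closed under linear combinations.\<close>

definition ae_recovered ::
  "(nat \<Rightarrow> (real \<Rightarrow> real) \<Rightarrow> real \<Rightarrow> real) \<Rightarrow> (real \<Rightarrow> real) \<Rightarrow> bool" where
  "ae_recovered U f \<longleftrightarrow> integrable unit_leb f \<and> (AE x in unit_leb. (\<lambda>n. U n f x) \<longlonglongrightarrow> f x)"

lemma ae_recovered_add:
  assumes U: "\<And>n. bounded_operator_into Linf Linf_norm (U n)"
    and f: "ae_recovered U f" and g: "ae_recovered U g"
  shows "ae_recovered U (\<lambda>x. f x + g x)"
proof -
  have "AE x in unit_leb. \<forall>n. U n (\<lambda>y. f y + g y) x = U n f x + U n g x"
    unfolding AE_all_countable using f g by (blast intro: op_add[OF U] dest: ae_recovered_def[THEN iffD1])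
  moreover have "AE x in unit_leb. (\<lambda>n. U n f x) \<longlonglongrightarrow> f x" "AE x in unit_leb. (\<lambda>n. U n g x) \<longlonglongrightarrow> g x"
    using f g by (auto simp: ae_recovered_def)
  ultimately have "AE x in unit_leb. (\<lambda>n. U n (\<lambda>y. f y + g y) x) \<longlonglongrightarrow> f x + g x"
    by eventually_elim (simp add: tendsto_add)
  then show ?thesis
    using f g by (simp add: ae_recovered_def)
qed

lemma ae_recovered_scale:
  assumes U: "\<And>n. bounded_operator_into Linf Linf_norm (U n)" and f: "ae_recovered U f"
  shows "ae_recovered U (\<lambda>x. c * f x)"
proof -
  have "AE x in unit_leb. \<forall>n. U n (\<lambda>y. c * f y) x = c * U n f x"
    unfolding AE_all_countable using f by (blast intro: op_scale[OF U] dest: ae_recovered_def[THEN iffD1])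
  moreover have "AE x in unit_leb. (\<lambda>n. U n f x) \<longlonglongrightarrow> f x"
    using f by (auto simp: ae_recovered_def)
  ultimately have "AE x in unit_leb. (\<lambda>n. U n (\<lambda>y. c * f y) x) \<longlonglongrightarrow> c * f x"
    by eventually_elim (simp add: tendsto_mult_left)
  then show ?thesis
    using f by (simp add: ae_recovered_def)
qed

lemma ae_recovered_zero:
  assumes U: "\<And>n. bounded_operator_into Linf Linf_norm (U n)"
  shows "ae_recovered U (\<lambda>_. 0)"
proof -
  have "AE x in unit_leb. \<forall>n. U n (\<lambda>_. 0) x = 0"
    unfolding AE_all_countable using op_scale[OF U, of "\<lambda>_. 0" _ 0] by simp
  then have "AE x in unit_leb. (\<lambda>n. U n (\<lambda>_. 0) x) \<longlonglongrightarrow> 0"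
    by eventually_elim simp
  then show ?thesis
    by (simp add: ae_recovered_def)
qed

section \<open>Almost everywhere recovery of indicators of intervals and finite-interval
  sets\<close>

lemma unit_interval_measurable: "unit_interval J \<Longrightarrow> J \<in> sets lebesgue \<and> J \<subseteq> {0..<1}"
  by (auto simp: unit_interval_def)

lemma unit_interval_Int: "unit_interval I \<Longrightarrow> unit_interval J \<Longrightarrow> I \<inter> J = {} \<or> unit_interval (I \<inter> J)"
proof -
  assume "unit_interval I" "unit_interval J"
  then obtain a b c d where "0 \<le> a" "a < b" "b \<le> 1" "0 \<le> c" "c < d" "d \<le> 1"
    "I = {a..<b}" "J = {c..<d}"
    by (auto simp: unit_interval_def)
  then have "I \<inter> J = {max a c..<min b d}" "0 \<le> max a c" "min b d \<le> 1"
    by auto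
  then show ?thesis
    unfolding unit_interval_def by (metis atLeastLessThan_empty not_less)
qed

lemma integrable_indicator_unit_leb: "A \<in> sets lebesgue \<Longrightarrow> integrable unit_leb (indicat_real A)"
  by (intro unit_leb.integrable_const_bound[where B = 1])
     (auto simp: indicator_def intro!: borel_measurable_indicator measurable_restrict_space1)

text \<open>Property (C) gives an a.e. limit, and a subsequence coming from (B) identifies it.\<close>

lemma ae_recovered_interval:
  assumes U: "\<And>n. bounded_operator_into Linf Linf_norm (U n)"
    and p: "1 < p" and B: "property_B p U" and C: "property_C U" and J: "unit_interval J"
  shows "ae_recovered U (indicat_real J)"
proof -
  let ?f = "indicat_real J"
  have int: "integrable unit_leb ?f"
    using unit_interval_measurable[OF J] by (intro integrable_indicator_unit_leb) auto
  have "(\<lambda>x. \<bar>?f x\<bar> powr p) = ?f"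
    using p by (auto simp: indicator_def)
  then have "?f \<in> Lp p"
    using int by (simp add: Lp_def borel_measurable_integrable)
  then have lim: "(\<lambda>n. Lp_norm p (\<lambda>x. U n ?f x - ?f x)) \<longlonglongrightarrow> 0"
    using B by (auto simp: property_B_def)
  define u where "u n x = \<bar>U n ?f x - ?f x\<bar> powr p" for n x
  have [measurable]: "U n ?f \<in> borel_measurable unit_leb" "?f \<in> borel_measurable unit_leb" for n
    using op_measurable[OF U int] int by auto
  have u_int: "integrable unit_leb (u n)" for n
  proof (rule unit_leb.integrable_const_bound)
    \<comment> \<open>The summand 1 bounds the indicator; the other summand bounds its image under
      \<open>U n\<close>.\<close>
    show "AE x in unit_leb. norm (u n x) \<le> (Linf_norm (U n ?f) + 1) powr p"
      using Linf_bounded[OF op_Linf[OF U int], of n]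
      by eventually_elim (use p in \<open>auto simp: u_def indicator_def intro!: powr_mono2\<close>)
  qed (unfold u_def, measurable)
  \<comment> \<open>The p-th power turns norm convergence into L^1 convergence of
    \<open>u n\<close>, which admits an a.e. convergent subsequence.\<close>
  have "(\<lambda>n. Lp_norm p (\<lambda>x. U n ?f x - ?f x) powr p) \<longlonglongrightarrow> 0 powr p"
    using lim p by (intro tendsto_powr2) (auto simp: Lp_norm_def)
  then have "(\<lambda>n. LINT x|unit_leb. norm (u n x)) \<longlonglongrightarrow> 0"
    using p by (simp add: Lp_norm_def powr_powr u_def)
  from tendsto_L1_AE_subseq[OF u_int this] obtain r where
    r: "strict_mono r" "AE x in unit_leb. (\<lambda>n. u (r n) x) \<longlonglongrightarrow> 0"
    by blast
  have "AE x in unit_leb. convergent (\<lambda>n. U n ?f x)"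
    using C J by (auto simp: property_C_def)
  then have "AE x in unit_leb. (\<lambda>n. U n ?f x) \<longlonglongrightarrow> ?f x"
    using r(2)
  proof eventually_elim
    case (elim x)
    then obtain L where L: "(\<lambda>n. U n ?f x) \<longlonglongrightarrow> L"
      by (auto simp: convergent_def)
    have "(\<lambda>n. u (r n) x powr (1 / p)) \<longlonglongrightarrow> 0 powr (1 / p)"
      using elim p by (intro tendsto_powr2) (auto simp: u_def)
    then have "(\<lambda>n. \<bar>U (r n) ?f x - ?f x\<bar>) \<longlonglongrightarrow> 0"
      using p by (simp add: u_def powr_powr)
    then have "(\<lambda>n. U (r n) ?f x) \<longlonglongrightarrow> ?f x"
      by (subst (asm) tendsto_rabs_zero_iff) (rule Lim_null[THEN iffD2])
    moreover have "(\<lambda>n. U (r n) ?f x) \<longlonglongrightarrow> L"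
      using LIMSEQ_subseq_LIMSEQ[OF L r(1)] by (simp add: o_def)
    ultimately show ?case
      using L LIMSEQ_unique by blast
  qed
  with int show ?thesis
    by (simp add: ae_recovered_def)
qed

text \<open>The intervals may overlap, so the induction adds one interval I by inclusion-exclusion:
  the indicator on J of the enlarged union is that of \<open>I \<inter> J\<close> plus that of the
  old union on J minus that of the old union on \<open>I \<inter> J\<close>. The last term is why J
  is arbitrary in the induction; an empty \<open>I \<inter> J\<close> is split off because it is no
  \<open>unit_interval\<close>.\<close>

lemma ae_recovered_finite_interval_set:
  assumes U: "\<And>n. bounded_operator_into Linf Linf_norm (U n)"
    and intv: "\<And>J. unit_interval J \<Longrightarrow> ae_recovered U (indicat_real J)"
    and G: "finite_interval_set G" and J: "unit_interval J"
  shows "ae_recovered U (indicat_real (G \<inter> J))"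
proof -
  obtain F where F: "finite F" "\<forall>I\<in>F. unit_interval I" "G = \<Union>F"
    using G by (auto simp: finite_interval_set_def)
  have "ae_recovered U (indicat_real (\<Union>F \<inter> J))"
    using F(1,2) J
  proof (induction F arbitrary: J rule: finite_induct)
    case empty
    then show ?case using ae_recovered_zero[of U, OF U] by (simp add: indicator_def[abs_def])
  next
    case (insert I F)
    show ?case
    proof (cases "I \<inter> J = {}")
      case True
      then have "\<Union>(insert I F) \<inter> J = \<Union>F \<inter> J" by auto
      then show ?thesis using insert by simp
    next
      case False
      then have IJ: "unit_interval (I \<inter> J)"
        using insert.prems unit_interval_Int by auto
      have "ae_recovered U (\<lambda>x. (indicat_real (I \<inter> J) x + indicat_real (\<Union>F \<inter> J) x)
          + (-1) * indicat_real (\<Union>F \<inter> (I \<inter> J)) x)"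
        using insert IJ by (intro ae_recovered_add ae_recovered_scale U intv insert.IH) auto
      also have "(\<lambda>x. (indicat_real (I \<inter> J) x + indicat_real (\<Union>F \<inter> J) x)
          + (-1) * indicat_real (\<Union>F \<inter> (I \<inter> J)) x) = indicat_real (\<Union>(insert I F) \<inter> J)"
        by (auto simp: indicator_def fun_eq_iff)
      finally show ?thesis .
    qed
  qed
  then show ?thesis
    using F(3) by simp
qed

subsection \<open>Expansion in indicators of basis intervals\<close>

text \<open>Absolute convergence makes the double series unconditional, so it may be enumerated
  along the pairing bijection. It serves to turn a series of step functions, with partitions of
  varying size, into one series of indicators; rows are padded with zeros.\<close>

lemma sums_prod_decode:
  fixes a :: "nat \<Rightarrow> nat \<Rightarrow> real"
  assumes zero: "\<And>s j. j \<ge> l s \<Longrightarrow> a s j = 0"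
    and abs: "summable (\<lambda>s. \<Sum>j<l s. \<bar>a s j\<bar>)"
    and S: "(\<lambda>s. \<Sum>j<l s. a s j) sums S"
  shows "(\<lambda>k. case prod_decode k of (s, j) \<Rightarrow> a s j) sums S"
    and "summable (\<lambda>k. \<bar>case prod_decode k of (s, j) \<Rightarrow> a s j\<bar>)"
proof -
  have inner: "((\<lambda>j. b j) has_sum (\<Sum>j<l s. b j)) UNIV" if "\<And>j. j \<ge> l s \<Longrightarrow> b j = 0" for b :: "nat \<Rightarrow> real" and s
    by (rule has_sum_finite_neutralI[of "{..<l s}"]) (use that in auto)
  have a: "((\<lambda>j. a s j) has_sum (\<Sum>j<l s. a s j)) UNIV" "((\<lambda>j. \<bar>a s j\<bar>) has_sum (\<Sum>j<l s. \<bar>a s j\<bar>)) UNIV" for s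
    using zero by (auto intro!: inner)
  have sum: "(\<lambda>z. norm (case z of (s, j) \<Rightarrow> a s j)) summable_on UNIV \<times> UNIV"
    unfolding Infinite_Sum.abs_summable_on_Sigma_iff
  proof (intro conjI ballI)
    show "(\<lambda>j. norm (case (s, j) of (s, j) \<Rightarrow> a s j)) summable_on UNIV" for s
      using a(2)[of s] by (auto simp: summable_on_def)
    have eq: "(\<Sum>\<^sub>\<infinity>j. norm (case (s, j) of (s, j) \<Rightarrow> a s j)) = (\<Sum>j<l s. \<bar>a s j\<bar>)" for s
      using infsumI[OF a(2)] by auto
    have "(\<lambda>s. norm (\<Sum>j<l s. \<bar>a s j\<bar>)) summable_on UNIV"
      using abs by (subst summable_on_UNIV_nonneg_real_iff) auto
    then show "(\<lambda>s. norm (\<Sum>\<^sub>\<infinity>j. norm (case (s, j) of (s, j) \<Rightarrow> a s j))) summable_on UNIV"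
      by (simp only: eq)
  qed
  have "((\<lambda>s. \<Sum>j<l s. a s j) has_sum S) UNIV"
    by (rule norm_summable_imp_has_sum[OF _ S])
      (auto intro!: summable_comparison_test'[OF abs, of 0] sum_abs)
  then have "infsum (\<lambda>(s, j). a s j) (UNIV \<times> UNIV) = S"
    using infsum_Sigma_banach[OF abs_summable_summable[OF sum]] infsumI[OF a(1)] infsumI
    by (simp add: infsumI)
  then have *: "((\<lambda>(s, j). a s j) has_sum S) UNIV"
    using has_sum_infsum[OF abs_summable_summable[OF sum]] by simp
  show "(\<lambda>k. case prod_decode k of (s, j) \<Rightarrow> a s j) sums S"
    using * by (intro has_sum_imp_sums)
      (subst has_sum_reindex_bij_betw[OF bij_prod_decode, of "\<lambda>(s, j). a s j"])
  have "(\<lambda>k. norm (case prod_decode k of (s, j) \<Rightarrow> a s j)) summable_on UNIV"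
    using sum
    by (subst summable_on_reindex_bij_betw[OF bij_prod_decode, of "\<lambda>y. norm (case y of (s, j) \<Rightarrow> a s j)"]) simp
  then show "summable (\<lambda>k. \<bar>case prod_decode k of (s, j) \<Rightarrow> a s j\<bar>)"
    by (subst (asm) summable_on_UNIV_nonneg_real_iff) auto
qed

section \<open>Uniform partitions of [0,1) and approximation by step functions\<close>

definition cell :: "nat \<Rightarrow> nat \<Rightarrow> real set" where
  "cell l j = {real j / real l ..< real (Suc j) / real l}"

lemma cell_iff:
  assumes "l > 0" "x \<ge> 0"
  shows "x \<in> cell l j \<longleftrightarrow> j = nat \<lfloor>real l * x\<rfloor>"
proof -
  have "x \<in> cell l j \<longleftrightarrow> real j \<le> real l * x \<and> real l * x < real j + 1"
    using assms by (auto simp: cell_def field_simps)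
  also have "\<dots> \<longleftrightarrow> \<lfloor>real l * x\<rfloor> = int j"
    by (auto simp: floor_eq_iff)
  also have "\<dots> \<longleftrightarrow> j = nat \<lfloor>real l * x\<rfloor>"
    using assms by auto
  finally show ?thesis .
qed

lemma unit_interval_cell:
  assumes "j < l"
  shows "unit_interval (cell l j)"
  unfolding unit_interval_def cell_def using assms
  by (intro exI[of _ "real j / real l"] exI[of _ "real (Suc j) / real l"]) (auto simp: field_simps)

definition step_fn :: "nat \<Rightarrow> (nat \<Rightarrow> real) \<Rightarrow> real \<Rightarrow> real" where
  "step_fn l c x = (\<Sum>j<l. c j * indicat_real (cell l j) x)"

lemma step_fn_eq:
  assumes "l > 0" "x \<in> {0..<1}"
  shows "step_fn l c x = c (nat \<lfloor>real l * x\<rfloor>)"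
proof -
  have "\<lfloor>real l * x\<rfloor> < int l"
    using assms by (auto simp: floor_less_iff)
  then have "nat \<lfloor>real l * x\<rfloor> < l"
    using assms by auto
  moreover have "step_fn l c x = (\<Sum>j<l. if j = nat \<lfloor>real l * x\<rfloor> then c j else 0)"
    unfolding step_fn_def using assms by (intro sum.cong) (auto simp: cell_iff indicator_def)
  ultimately show ?thesis
    by simp
qed

lemma integral_indicator_unit:
  "A \<subseteq> {0..<1} \<Longrightarrow> A \<in> sets lebesgue \<Longrightarrow> (LINT x|unit_leb. indicat_real A x) = measure lebesgue A"
  using measure_unit_leb[of A] by (simp add: space_restrict_space Int_absorb2)

lemma integrable_step_fn: "integrable unit_leb (step_fn l c)"
  unfolding step_fn_def
  by (intro Bochner_Integration.integrable_sum integrable_mult_right integrable_indicator_unit_leb)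
    (auto simp: cell_def)

lemma integral_abs_step_fn:
  assumes "l > 0"
  shows "(LINT x|unit_leb. \<bar>step_fn l c x\<bar>) = (\<Sum>j<l. \<bar>c j\<bar> * measure lebesgue (cell l j))"
proof -
  \<comment> \<open>Each point of [0,1) lies in exactly one cell, so the absolute value moves onto
    the coefficients.\<close>
  have "(LINT x|unit_leb. \<bar>step_fn l c x\<bar>) = (LINT x|unit_leb. step_fn l (\<lambda>j. \<bar>c j\<bar>) x)"
    using assms by (intro Bochner_Integration.integral_cong) (auto simp: step_fn_eq)
  also have "\<dots> = (\<Sum>j<l. LINT x|unit_leb. \<bar>c j\<bar> * indicat_real (cell l j) x)"
    unfolding step_fn_def
    by (intro Bochner_Integration.integral_sum integrable_mult_right integrable_indicator_unit_leb)
      (auto simp: cell_def)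
  also have "\<dots> = (\<Sum>j<l. \<bar>c j\<bar> * measure lebesgue (cell l j))"
    using unit_interval_measurable[OF unit_interval_cell]
    by (intro sum.cong) (simp_all add: integral_indicator_unit del: Bochner_Integration.integral_indicator)
  finally show ?thesis .
qed

lemma dominated_L1_convergence:
  fixes s :: "nat \<Rightarrow> 'a \<Rightarrow> real"
  assumes [measurable]: "f \<in> borel_measurable M" "\<And>i. s i \<in> borel_measurable M" and w: "integrable M w"
    and lim: "AE x in M. (\<lambda>i. s i x) \<longlonglongrightarrow> f x" and bound: "\<And>i. AE x in M. \<bar>f x - s i x\<bar> \<le> w x"
  shows "(\<lambda>i. LINT x|M. \<bar>f x - s i x\<bar>) \<longlonglongrightarrow> 0"
proof -
  have "(\<lambda>i. LINT x|M. \<bar>f x - s i x\<bar>) \<longlonglongrightarrow> (LINT x|M. 0)"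
  proof (rule integral_dominated_convergence[OF _ _ w])
    show "AE x in M. (\<lambda>i. \<bar>f x - s i x\<bar>) \<longlonglongrightarrow> 0"
      using lim
    proof eventually_elim
      case (elim x)
      have "(\<lambda>i. \<bar>f x - s i x\<bar>) \<longlonglongrightarrow> \<bar>f x - f x\<bar>"
        by (intro tendsto_intros elim)
      then show ?case by simp
    qed
  qed (use bound in auto)
  then show ?thesis by simp
qed

text \<open>Every sufficiently large \<open>l\<close> must work, not just some: a basis provides
  infinitely many partition sizes, but no control over which. The error is split in three:
  truncation of f, a continuous approximation of the truncation, and sampling of the continuous
  function.\<close>

lemma step_fn_approximation:
  assumes f: "integrable unit_leb f" and e: "e > 0"
  shows "\<exists>N. \<forall>l\<ge>N. \<exists>c. (LINT x|unit_leb. \<bar>f x - step_fn l c x\<bar>) < e"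
proof -
  \<comment> \<open>Truncation is continuous and bounded, so it also applies to the continuous
    approximants of f, and constants dominate in the last two of the three limits.\<close>
  define clamp where "clamp B y = max (- B) (min B y)" for B y :: real
  have clamp_bd: "\<bar>clamp B y\<bar> \<le> B" if "B \<ge> 0" for B y
    using that by (auto simp: clamp_def)
  have clamp_cont: "continuous_on A (clamp B)" for A B
    unfolding clamp_def by (intro continuous_intros)
  have [measurable]: "clamp B \<in> borel_measurable borel" for B
    unfolding clamp_def by measurable
  have fm [measurable]: "f \<in> borel_measurable unit_leb"
    using f by auto
  have "(\<lambda>n. LINT x|unit_leb. \<bar>f x - clamp (real n) (f x)\<bar>) \<longlonglongrightarrow> 0"
  proof (rule dominated_L1_convergence)
    show "AE x in unit_leb. (\<lambda>n. clamp (real n) (f x)) \<longlonglongrightarrow> f x"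
    proof (intro AE_I2 tendsto_eventually)
      fix x
      obtain n0 where "\<bar>f x\<bar> \<le> real n0"
        using real_arch_simple by blast
      then show "\<forall>\<^sub>F n in sequentially. clamp (real n) (f x) = f x"
        by (intro eventually_sequentiallyI[of n0]) (auto simp: clamp_def)
    qed
    show "AE x in unit_leb. \<bar>f x - clamp (real n) (f x)\<bar> \<le> \<bar>f x\<bar>" for n
      by (auto simp: clamp_def)
  qed (use f in auto)
  from order_tendstoD(2)[OF this, of "e / 3"] obtain n where
    n: "(LINT x|unit_leb. \<bar>f x - clamp (real n) (f x)\<bar>) < e / 3"
    using e by (auto simp: eventually_sequentially)
  define B where "B = real n"
  have B: "B \<ge> 0" by (simp add: B_def)
  \<comment> \<open>\<open>measurable_on\<close> supplies continuous functions converging to f off a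
    negligible set.\<close>
  have "f measurable_on {0..<1}"
    using fm by (subst measurable_on_iff_borel_measurable) auto
  then obtain N g where N: "negligible N" and g: "\<And>n. continuous_on UNIV (g n)"
    and lim: "\<And>x. x \<notin> N \<Longrightarrow> (\<lambda>n. g n x) \<longlonglongrightarrow> (if x \<in> {0..<1} then f x else (0::real))"
    unfolding measurable_on_def by blast
  have "AE x in lebesgue. x \<notin> N"
    using N by (simp add: negligible_iff_null_sets AE_not_in)
  then have N': "AE x in unit_leb. x \<notin> N"
    by (simp add: AE_restrict_space_iff) (auto elim: eventually_mono)
  have hm: "h \<in> borel_measurable unit_leb" if "continuous_on UNIV h" for h :: "real \<Rightarrow> real"
    using borel_measurable_continuous_onI[OF that]
    by (intro measurable_restrict_space1 measurable_completion) simp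
  have gcl: "continuous_on UNIV (\<lambda>x. clamp B (g m x))" for m
    using continuous_on_compose2[OF clamp_cont g] by auto
  have "(\<lambda>m. LINT x|unit_leb. \<bar>clamp B (f x) - clamp B (g m x)\<bar>) \<longlonglongrightarrow> 0"
  proof (rule dominated_L1_convergence)
    show "AE x in unit_leb. (\<lambda>m. clamp B (g m x)) \<longlonglongrightarrow> clamp B (f x)"
      using N' AE_space
    proof eventually_elim
      case (elim x)
      then have "(\<lambda>n. g n x) \<longlonglongrightarrow> f x"
        using lim[of x] by (simp add: space_restrict_space)
      then show ?case
        by (rule continuous_on_tendsto_compose[OF clamp_cont[of UNIV B]]) simp_all
    qed
    show "AE x in unit_leb. \<bar>clamp B (f x) - clamp B (g m x)\<bar> \<le> 2 * B" for m
    proof (rule AE_I2)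
      show "\<bar>clamp B (f x) - clamp B (g m x)\<bar> \<le> 2 * B" for x
        using clamp_bd[OF B, of "f x"] clamp_bd[OF B, of "g m x"] by linarith
    qed
  qed (use hm gcl in auto)
  from order_tendstoD(2)[OF this, of "e / 3"] obtain m where
    m: "(LINT x|unit_leb. \<bar>clamp B (f x) - clamp B (g m x)\<bar>) < e / 3"
    using e by (auto simp: eventually_sequentially)
  define h where "h x = clamp B (g m x)" for x
  have h: "continuous_on UNIV h" "\<And>x. \<bar>h x\<bar> \<le> B"
    using gcl clamp_bd[OF B] by (auto simp: h_def)
  have [measurable]: "h \<in> borel_measurable unit_leb"
    using hm h by auto
  \<comment> \<open>Sampling at left endpoints: the sample point for x is within 1/l of x, so
    continuity at x gives convergence there.\<close>
  define s where "s l = step_fn l (\<lambda>j. h (real j / real l))" for l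
  have [measurable]: "s l \<in> borel_measurable unit_leb" for l
    unfolding s_def using integrable_step_fn by auto
  have "(\<lambda>l. LINT x|unit_leb. \<bar>h x - s l x\<bar>) \<longlonglongrightarrow> 0"
  proof (rule dominated_L1_convergence)
    show "AE x in unit_leb. (\<lambda>l. s l x) \<longlonglongrightarrow> h x"
    proof (rule AE_I2)
      fix x assume "x \<in> space unit_leb"
      then have x: "x \<in> {0..<1}" by (simp add: space_restrict_space)
      have near: "norm (real (nat \<lfloor>real l * x\<rfloor>) / real l - x) \<le> 1 / real l" if "l > 0" for l
      proof -
        have "real (nat \<lfloor>real l * x\<rfloor>) = of_int \<lfloor>real l * x\<rfloor>"
          using x by (simp add: of_nat_nat)
        then have "\<bar>real (nat \<lfloor>real l * x\<rfloor>) - real l * x\<bar> \<le> 1"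
          by linarith
        moreover have "real (nat \<lfloor>real l * x\<rfloor>) / real l - x = (real (nat \<lfloor>real l * x\<rfloor>) - real l * x) / real l"
          using that by (simp add: field_simps)
        ultimately show ?thesis
          using that by (simp add: divide_right_mono)
      qed
      have "(\<lambda>l. real (nat \<lfloor>real l * x\<rfloor>) / real l - x) \<longlonglongrightarrow> 0"
        by (rule Lim_null_comparison[OF _ lim_1_over_n])
          (use near in \<open>auto intro!: eventually_sequentiallyI[of 1]\<close>)
      then have "(\<lambda>l. real (nat \<lfloor>real l * x\<rfloor>) / real l) \<longlonglongrightarrow> x"
        by (rule Lim_null[THEN iffD2])
      then have "(\<lambda>l. h (real (nat \<lfloor>real l * x\<rfloor>) / real l)) \<longlonglongrightarrow> h x"
        by (rule continuous_on_tendsto_compose[OF h(1)]) simp_all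
      moreover have "\<forall>\<^sub>F l in sequentially. h (real (nat \<lfloor>real l * x\<rfloor>) / real l) = s l x"
        using x by (intro eventually_sequentiallyI[of 1]) (simp add: s_def step_fn_eq)
      ultimately show "(\<lambda>l. s l x) \<longlonglongrightarrow> h x"
        by (rule Lim_transform_eventually)
    qed
    show "AE x in unit_leb. \<bar>h x - s l x\<bar> \<le> 2 * B" for l
    proof (rule AE_I2)
      fix x assume "x \<in> space unit_leb"
      then have x: "x \<in> {0..<1}" by (simp add: space_restrict_space)
      \<comment> \<open>Domination is required for every index, hence also for \<open>l = 0\<close>,
        where the step function is an empty sum.\<close>
      have "\<bar>s l x\<bar> \<le> B"
        using h(2) x B by (cases "l > 0") (auto simp: s_def step_fn_eq, simp add: step_fn_def)
      then show "\<bar>h x - s l x\<bar> \<le> 2 * B"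
        using h(2)[of x] by linarith
    qed
  qed auto
  from order_tendstoD(2)[OF this, of "e / 3"] obtain N where
    N: "\<And>l. l \<ge> N \<Longrightarrow> (LINT x|unit_leb. \<bar>h x - s l x\<bar>) < e / 3"
    using e by (auto simp: eventually_sequentially)
  have "(LINT x|unit_leb. \<bar>f x - s l x\<bar>) < e" if "l \<ge> N" for l
  proof -
    have ci: "integrable unit_leb (\<lambda>x. clamp B (f x))" "integrable unit_leb h" "integrable unit_leb (s l)"
      using clamp_bd[OF B] h(2) integrable_step_fn
      by (auto intro!: unit_leb.integrable_const_bound[where B = B] simp: s_def)
    have "(LINT x|unit_leb. \<bar>f x - s l x\<bar>) \<le> (LINT x|unit_leb. \<bar>f x - clamp B (f x)\<bar>
        + \<bar>clamp B (f x) - h x\<bar> + \<bar>h x - s l x\<bar>)"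
      using f ci by (intro integral_mono) auto
    also have "\<dots> = (LINT x|unit_leb. \<bar>f x - clamp B (f x)\<bar>)
        + (LINT x|unit_leb. \<bar>clamp B (f x) - h x\<bar>) + (LINT x|unit_leb. \<bar>h x - s l x\<bar>)"
      using f ci by simp
    also have "\<dots> < e"
      using n m N[OF that] by (simp add: B_def h_def)
    finally show ?thesis .
  qed
  then show ?thesis
    unfolding s_def by blast
qed

text \<open>This is the refinement condition of a basis applied to [0,1), with the pieces renumbered
  from 0 instead of 1.\<close>

lemma basis_cells:
  assumes "interval_basis I"
  shows "infinite {l. l > 0 \<and> (\<forall>j<l. cell l j \<in> I)}"
proof -
  have "infinite {l::nat. l > 0 \<and>
      (\<forall>j\<in>{1..l}. {0 + (1 - 0) * (real j - 1) / real l ..< 0 + (1 - 0) * real j / real l} \<in> I)}"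
    by (rule assms[unfolded interval_basis_def, THEN conjunct2, THEN conjunct2, THEN conjunct2,
          rule_format, OF conjI[OF zero_less_one]])
      (use assms in \<open>simp add: interval_basis_def\<close>)
  moreover have "{l::nat. l > 0 \<and>
      (\<forall>j\<in>{1..l}. {0 + (1 - 0) * (real j - 1) / real l ..< 0 + (1 - 0) * real j / real l} \<in> I)}
      \<subseteq> {l. l > 0 \<and> (\<forall>j<l. cell l j \<in> I)}"
  proof (safe, goal_cases)
    case (1 l j)
    then have "Suc j \<in> {1..l}" by auto
    from 1(2)[rule_format, OF this] show ?case
      by (simp add: cell_def)
  qed
  ultimately show ?thesis
    using finite_subset by blast
qed

text \<open>Successive approximation: each remainder is approximated by a step function within
  2^{-s}, and the difference is the next remainder. The step functions then have norm at most that
  of the remainder plus 2^{-s}, hence summable norms, and their partial sums telescope to f.\<close>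

lemma basis_series_expansion:
  assumes f: "integrable unit_leb f" and I: "interval_basis I"
  obtains c :: "nat \<Rightarrow> real" and D :: "nat \<Rightarrow> real set" where
    "\<And>k. D k \<in> I" "summable (\<lambda>k. \<bar>c k\<bar> * measure lebesgue (D k))"
    "AE x in unit_leb. (\<lambda>k. c k * indicat_real (D k) x) sums f x"
proof -
  define good where "good l \<longleftrightarrow> l > 0 \<and> (\<forall>j<l. cell l j \<in> I)" for l
  have approx: "\<exists>l c. good l \<and> (LINT x|unit_leb. \<bar>r x - step_fn l c x\<bar>) < e"
    if r: "integrable unit_leb r" "e > 0" for r e
  proof -
    obtain N where "\<forall>l\<ge>N. \<exists>c. (LINT x|unit_leb. \<bar>r x - step_fn l c x\<bar>) < e"
      using step_fn_approximation[OF r] by blast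
    moreover obtain l where "l \<ge> N" "good l"
      using basis_cells[OF I] unfolding infinite_nat_iff_unbounded_le good_def by auto
    ultimately show ?thesis by blast
  qed
  \<comment> \<open>In a state \<open>(l, c, r)\<close> the function \<open>r\<close> is the
    remainder still to be expanded and \<open>step_fn l c\<close> its approximant; the clause for
    \<open>s = 0\<close> anchors the recursion at f.\<close>
  define P where "P s y \<longleftrightarrow> (case y of (l, c, r) \<Rightarrow> good l \<and> integrable unit_leb r \<and>
    (LINT x|unit_leb. \<bar>r x - step_fn l c x\<bar>) < (1 / 2) ^ s \<and> (s = 0 \<longrightarrow> r = f))" for s :: nat and y
  define Q where "Q y z \<longleftrightarrow> (case y of (l, c, r) \<Rightarrow> \<forall>x. snd (snd z) x = r x - step_fn l c x)"
    for y z :: "nat \<times> (nat \<Rightarrow> real) \<times> (real \<Rightarrow> real)"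
  have "\<exists>y. P 0 y"
    using approx[OF f, of 1] f by (auto simp: P_def)
  moreover have "\<exists>z. P (Suc s) z \<and> Q y z" if "P s y" for s y
  proof -
    obtain l c r where y: "y = (l, c, r)" by (cases y)
    then have "integrable unit_leb (\<lambda>x. r x - step_fn l c x)"
      using that integrable_step_fn by (auto simp: P_def)
    from approx[OF this, of "(1/2)^Suc s"] obtain l' c' where "good l'"
      "(LINT x|unit_leb. \<bar>(r x - step_fn l c x) - step_fn l' c' x\<bar>) < (1/2)^Suc s"
      by auto
    then show ?thesis
      using \<open>integrable unit_leb (\<lambda>x. r x - step_fn l c x)\<close> y
      by (intro exI[of _ "(l', c', \<lambda>x. r x - step_fn l c x)"]) (simp add: P_def Q_def)
  qed
  ultimately obtain y where y: "\<And>s. P s (y s)" "\<And>s. Q (y s) (y (Suc s))"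
    using dependent_nat_choice[of P "\<lambda>_. Q"] by blast
  define l where "l s = fst (y s)" for s
  define c where "c s = fst (snd (y s))" for s
  define r where "r s = snd (snd (y s))" for s
  define u where "u s = step_fn (l s) (c s)" for s
  have good: "good (l s)" and r_int: "integrable unit_leb (r s)" and r0: "r 0 = f"
    and small: "(LINT x|unit_leb. \<bar>r s x - u s x\<bar>) < (1 / 2) ^ s" for s
    using y(1)[of s] y(1)[of 0] by (auto simp: P_def l_def c_def r_def u_def split: prod.splits)
  have r_Suc: "r (Suc s) x = r s x - u s x" for s x
    using y(2)[of s] by (auto simp: Q_def l_def c_def r_def u_def split: prod.splits)
  have r_bd: "(LINT x|unit_leb. \<bar>r (Suc s) x\<bar>) < (1/2)^s" for s
    using small[of s] by (simp add: r_Suc)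
  have u_int: "integrable unit_leb (u s)" for s
    by (simp add: u_def integrable_step_fn)
  have "summable (\<lambda>s. LINT x|unit_leb. \<bar>r (Suc s) x\<bar>)"
    by (rule summable_comparison_test'[OF summable_geometric[of "1/2::real"], of 0])
      (use r_bd in \<open>auto intro: less_imp_le simp: abs_of_nonneg\<close>)
  \<comment> \<open>The norm of \<open>r 0 = f\<close> is not bounded by a power of 1/2, but a
    single extra term leaves summability intact.\<close>
  then have r_sum: "summable (\<lambda>s. LINT x|unit_leb. \<bar>r s x\<bar>)"
    by (subst (asm) summable_Suc_iff)
  have u_sum: "summable (\<lambda>s. LINT x|unit_leb. \<bar>u s x\<bar>)"
  proof (rule summable_comparison_test'[OF summable_add[OF r_sum summable_geometric[of "1/2::real"]], of 0])
    show "norm (LINT x|unit_leb. \<bar>u s x\<bar>) \<le> (LINT x|unit_leb. \<bar>r s x\<bar>) + (1/2)^s" for s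
    proof -
      have "(LINT x|unit_leb. \<bar>u s x\<bar>) \<le> (LINT x|unit_leb. \<bar>r s x\<bar> + \<bar>r s x - u s x\<bar>)"
        using r_int u_int by (intro integral_mono) auto
      also have "\<dots> = (LINT x|unit_leb. \<bar>r s x\<bar>) + (LINT x|unit_leb. \<bar>r s x - u s x\<bar>)"
        using r_int u_int by simp
      finally show ?thesis
        using small[of s] by simp
    qed
  qed simp
  define cc where "cc k = (case prod_decode k of (s, j) \<Rightarrow> if j < l s then c s j else 0)" for k
  \<comment> \<open>Padding terms have coefficient 0, but their set must still belong to the basis;
    [0,1) is a member of every basis.\<close>
  define D where "D k = (case prod_decode k of (s, j) \<Rightarrow> if j < l s then cell (l s) j else {0..<1})" for k
  have lpos: "l s > 0" for s using good[of s] by (simp add: good_def)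
  show ?thesis
  proof
    show "D k \<in> I" for k
      using good I by (auto simp: D_def good_def interval_basis_def split: prod.splits)
    have "(\<lambda>s. LINT x|unit_leb. \<bar>u s x\<bar>) = (\<lambda>s. \<Sum>j<l s. \<bar>c s j\<bar> * measure lebesgue (cell (l s) j))"
      using lpos by (simp add: u_def integral_abs_step_fn)
    then have sm: "summable (\<lambda>s. \<Sum>j<l s. \<bar>c s j\<bar> * measure lebesgue (cell (l s) j))"
      using u_sum by simp
    define a where "a s j = (if j < l s then \<bar>c s j\<bar> * measure lebesgue (cell (l s) j) else 0)" for s j
    have "summable (\<lambda>k. \<bar>case prod_decode k of (s, j) \<Rightarrow> a s j\<bar>)"
      using sm by (intro sums_prod_decode(2)[where l = l and S = "\<Sum>s. \<Sum>j<l s. a s j"] summable_sums)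
        (auto simp: a_def abs_mult)
    moreover have "\<bar>case prod_decode k of (s, j) \<Rightarrow> a s j\<bar> = \<bar>cc k\<bar> * measure lebesgue (D k)" for k
      by (auto simp: a_def cc_def D_def abs_mult split: prod.splits)
    ultimately show "summable (\<lambda>k. \<bar>cc k\<bar> * measure lebesgue (D k))"
      by simp
    show "AE x in unit_leb. (\<lambda>k. cc k * indicat_real (D k) x) sums f x"
      using AE_summable_of_integrals[OF r_int r_sum] AE_summable_of_integrals[OF u_int u_sum] AE_space
    proof eventually_elim
      case (elim x)
      then have x: "x \<in> {0..<1}" by (simp add: space_restrict_space)
      define b where "b s j = (if j < l s then c s j * indicat_real (cell (l s) j) x else 0)" for s j
      have b_sum: "(\<Sum>j<l s. b s j) = u s x" for s
        by (simp add: b_def u_def step_fn_def)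
      \<comment> \<open>Since the cells of a row are disjoint, its absolute sum at x is
        \<open>\<bar>u s x\<bar>\<close>; a.e. summability of these over \<open>s\<close> is what
        the enumeration needs.\<close>
      have "(\<Sum>j<l s. \<bar>b s j\<bar>) = step_fn (l s) (\<lambda>j. \<bar>c s j\<bar>) x" for s
        by (simp add: b_def step_fn_def abs_mult)
      also have "\<And>s. step_fn (l s) (\<lambda>j. \<bar>c s j\<bar>) x = \<bar>u s x\<bar>"
        using x lpos by (simp add: u_def step_fn_eq)
      finally have b_abs: "(\<Sum>j<l s. \<bar>b s j\<bar>) = \<bar>u s x\<bar>" for s .
      have part: "(\<Sum>s<m. u s x) = f x - r m x" for m
        by (induction m) (auto simp: r0 r_Suc)
      have "(\<lambda>m. r m x) \<longlonglongrightarrow> 0"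
        using summable_LIMSEQ_zero[OF elim(1)] by (simp add: tendsto_rabs_zero_iff)
      then have "(\<lambda>s. u s x) sums f x"
        unfolding sums_def part by (auto intro: tendsto_eq_intros)
      then have "(\<lambda>k. case prod_decode k of (s, j) \<Rightarrow> b s j) sums f x"
        using elim(2) by (intro sums_prod_decode(1)[where l = l]) (auto simp: b_sum b_abs, simp add: b_def)
      moreover have "(case prod_decode k of (s, j) \<Rightarrow> b s j) = cc k * indicat_real (D k) x" for k
        by (auto simp: b_def cc_def D_def split: prod.splits)
      ultimately show ?case by simp
    qed
  qed
qed

subsection \<open>The gliding hump\<close>

lemma strict_mono_bracket:
  fixes N :: "nat \<Rightarrow> nat"
  assumes N: "strict_mono N" and "N K \<le> n"
  shows "\<exists>k\<ge>K. N k \<le> n \<and> n < N (Suc k)"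
proof -
  define m where "m = (LEAST m. n < N m)"
  have "n < N (Suc n)"
    using strict_mono_imp_increasing[OF N, of "Suc n"] by simp
  then have m: "n < N m"
    unfolding m_def by (rule LeastI)
  then have "\<not> m \<le> K"
    using assms(2) strict_mono_mono[OF N] by (meson leD le_trans monoD)
  then obtain k where k: "m = Suc k" "k \<ge> K"
    by (cases m) auto
  then have "\<not> n < N k"
    unfolding m_def using not_less_Least[of k "\<lambda>m. n < N m"] by simp
  with k m show ?thesis
    by (intro exI[of _ k]) auto
qed

text \<open>This is the argument at one point x, free of measure theory: \<open>y n\<close> stands
  for U_n g, \<open>u n k\<close> for U_n of the k-th partial sum, \<open>a n k\<close> for U_n of
  its k-th term, \<open>w n k\<close> and \<open>q n k\<close> for U_n W_k and U_n \<psi>_k. With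
  \<open>N k \<le> n < N (Suc k)\<close>, the difference \<open>y n - L\<close> consists of the tail
  after \<open>Suc k\<close>, \<open>w n k - W k\<close>, \<open>q n k\<close> and
  \<open>W k - L\<close>, each below e/4.\<close>

lemma gliding_hump_pointwise:
  fixes u w a q :: "nat \<Rightarrow> nat \<Rightarrow> real" and y W h :: "nat \<Rightarrow> real"
  assumes N: "strict_mono N"
    and y: "\<And>n. u n \<longlonglongrightarrow> y n"
    and u_a: "\<And>n k. u n (Suc k) = u n k + a n k"
    and u_w: "\<And>n k. u n (Suc k) = w n k + q n k"
    and w: "\<forall>\<^sub>F k in sequentially. \<forall>n\<ge>N k. \<bar>w n k - W k\<bar> \<le> (1 / 2) ^ k"
    and q: "\<And>j. \<forall>\<^sub>F k in sequentially. \<forall>n. \<bar>q n k\<bar> \<le> 1 / real (Suc j)"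
    and h: "summable h" "\<And>n k. n < N k \<Longrightarrow> \<bar>a n k\<bar> \<le> h k"
    and W: "W \<longlonglongrightarrow> L"
  shows "y \<longlonglongrightarrow> L"
proof (rule LIMSEQ_I)
  fix e :: real assume e: "e > 0"
  \<comment> \<open>The sign of \<open>h k\<close> is read off from the bound on \<open>a\<close>,
    which speaks of some n only if \<open>N k\<close> is positive.\<close>
  have h0: "h k \<ge> 0" if "N k > 0" for k
    using h(2)[OF that] by linarith
  have tail: "\<bar>y n - u n (Suc k)\<bar> \<le> (\<Sum>i. h (i + Suc k))" if n: "n < N (Suc k)" for n k
  proof -
    \<comment> \<open>All terms after the k-th see n as an early index, so \<open>h\<close> bounds
      their contributions.\<close>
    have lt: "n < N (i + Suc k)" for i
      using n strict_mono_mono[OF N, THEN monoD, of "Suc k" "i + Suc k"] by simp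
    have hn: "h (i + Suc k) \<ge> 0" for i
      using lt[of i] by (intro h0) simp
    have sm: "summable (\<lambda>i. h (i + Suc k))"
      using h(1) by (subst summable_iff_shift)
    have part: "\<bar>u n (p + Suc k) - u n (Suc k)\<bar> \<le> (\<Sum>i<p. h (i + Suc k))" for p
    proof (induction p)
      case (Suc p)
      then show ?case
        using h(2)[OF lt[of p]] u_a[of n "p + Suc k"] by simp
    qed simp
    have "\<bar>u n (p + Suc k) - u n (Suc k)\<bar> \<le> (\<Sum>i. h (i + Suc k))" for p
      using part[of p] sum_le_suminf[OF sm, of "{..<p}"] hn by fastforce
    moreover have "(\<lambda>p. \<bar>u n (p + Suc k) - u n (Suc k)\<bar>) \<longlonglongrightarrow> \<bar>y n - u n (Suc k)\<bar>"
      using LIMSEQ_ignore_initial_segment[OF y[of n], of "Suc k"] by (intro tendsto_intros)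
    ultimately show ?thesis
      by (intro LIMSEQ_le_const2) auto
  qed
  have "(\<lambda>k. \<Sum>i. h (i + k)) \<longlonglongrightarrow> 0"
    by (rule suminf_exist_split2[OF h(1)])
  then have T: "(\<lambda>k. \<Sum>i. h (i + Suc k)) \<longlonglongrightarrow> 0"
    by (rule LIMSEQ_Suc)
  have P: "(\<lambda>k. (1 / 2 :: real) ^ k) \<longlonglongrightarrow> 0"
    by (rule LIMSEQ_realpow_zero) auto
  have W0: "(\<lambda>k. \<bar>W k - L\<bar>) \<longlonglongrightarrow> 0"
    using W by (simp add: tendsto_rabs_zero_iff Lim_null[symmetric])
  obtain j where j: "1 / real (Suc j) < e / 4"
    using nat_approx_posE[of "e / 4"] e by auto
  have "\<forall>\<^sub>F k in sequentially. (\<forall>n\<ge>N k. \<bar>w n k - W k\<bar> \<le> (1 / 2) ^ k) \<and> (\<forall>n. \<bar>q n k\<bar> \<le> 1 / real (Suc j))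
      \<and> (\<Sum>i. h (i + Suc k)) < e / 4 \<and> (1 / 2 :: real) ^ k < e / 4 \<and> \<bar>W k - L\<bar> < e / 4"
    using e by (intro eventually_conj w q order_tendstoD(2)[OF T] order_tendstoD(2)[OF P]
      order_tendstoD(2)[OF W0]) auto
  then obtain K where K: "\<And>k. k \<ge> K \<Longrightarrow> (\<forall>n\<ge>N k. \<bar>w n k - W k\<bar> \<le> (1 / 2) ^ k)
      \<and> (\<forall>n. \<bar>q n k\<bar> \<le> 1 / real (Suc j))
      \<and> (\<Sum>i. h (i + Suc k)) < e / 4 \<and> (1 / 2 :: real) ^ k < e / 4 \<and> \<bar>W k - L\<bar> < e / 4"
    unfolding eventually_sequentially by blast
  show "\<exists>no. \<forall>n\<ge>no. norm (y n - L) < e"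
  proof (intro exI allI impI)
    fix n assume "n \<ge> N K"
    then obtain k where k: "k \<ge> K" "N k \<le> n" "n < N (Suc k)"
      using strict_mono_bracket[OF N] by blast
    have "\<bar>w n k - W k\<bar> \<le> (1 / 2) ^ k" "(1 / 2) ^ k < e / 4" "\<bar>q n k\<bar> \<le> 1 / real (Suc j)"
      "(\<Sum>i. h (i + Suc k)) < e / 4" "\<bar>W k - L\<bar> < e / 4"
      using K[OF k(1)] k(2) by blast+
    then show "norm (y n - L) < e"
      using j tail[OF k(3)] u_w[of n k] unfolding real_norm_def by linarith
  qed
qed

lemma (in finite_measure) AE_eventually_not_in:
  assumes "\<And>k. A k \<in> sets M" "\<And>k. measure M (A k) \<le> b k" "summable b"
  shows "AE x in M. \<forall>\<^sub>F k in sequentially. x \<notin> A k"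
proof -
  have "summable (\<lambda>k. measure M (A k))"
    by (rule summable_comparison_test'[OF assms(3), of 0]) (use assms(2) in auto)
  then have "AE x in M. \<forall>\<^sub>F k in sequentially. x \<in> space M - A k"
    using assms(1) by (intro borel_cantelli_AE1) (auto simp: less_top[symmetric])
  then show ?thesis
    by eventually_elim (auto elim: eventually_mono)
qed

text \<open>
  The state of the recursive construction at stage \<open>k\<close> is \<open>(N, \<psi>, W)\<close> with
  $W = \sum_{i<k}(\varphi_i + \psi_i) + \varphi_k$. The threshold \<open>N\<close> depends on \<open>W\<close> only, so
  \<open>\<psi>\<close> can be chosen after it.
\<close>

lemma gliding_hump:
  assumes U: "\<And>n. bounded_operator_into Linf Linf_norm (U n)"
    and f: "integrable unit_leb f" and V: "V \<in> sets lebesgue"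
    and phi: "\<And>k. ae_recovered U (\<phi> k)" and phi_b: "\<And>k. (LINT x|unit_leb. \<bar>\<phi> k x\<bar>) \<le> b k"
    and b: "summable b" and phi_f: "AE x in unit_leb. (\<lambda>k. \<phi> k x) sums f x"
    and corr: "\<And>k N e. e > 0 \<Longrightarrow> \<exists>\<psi>. ae_recovered U \<psi> \<and> (\<forall>x. x \<notin> V \<longrightarrow> \<psi> x = 0) \<and>
        (LINT x|unit_leb. \<bar>\<psi> x\<bar>) \<le> K * b k \<and>
        (\<Sum>n<N. LINT x|unit_leb. \<bar>U n (\<lambda>x. \<phi> k x + \<psi> x) x\<bar>) < e \<and>
        (\<forall>t>0. t * measure unit_leb {x\<in>space unit_leb. \<exists>n. \<bar>U n \<psi> x\<bar> > t} \<le> K' * b k)"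
  shows "\<exists>g. integrable unit_leb g \<and> {x\<in>{0..<1}. f x \<noteq> g x} \<subseteq> V \<and>
    (AE x in unit_leb. (\<lambda>n. U n g x) \<longlonglongrightarrow> g x)"
proof -
  define bad where "bad N e W = {x\<in>space unit_leb. \<exists>n\<ge>N. \<bar>U n W x - W x\<bar> > e}" for N e W
  define big where "big t \<psi> = {x\<in>space unit_leb. \<exists>n. \<bar>U n \<psi> x\<bar> > t}" for t \<psi>
  \<comment> \<open>The weak-type clause is kept for every t, since arbitrarily small thresholds are
    applied to the finished sequence.\<close>
  define P where "P k st \<longleftrightarrow> (case st of (N, \<psi>, W) \<Rightarrow> ae_recovered U \<psi> \<and> (\<forall>x. x \<notin> V \<longrightarrow> \<psi> x = 0) \<and>
      (LINT x|unit_leb. \<bar>\<psi> x\<bar>) \<le> K * b k \<and>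
      (\<Sum>n<N. LINT x|unit_leb. \<bar>U n (\<lambda>x. \<phi> k x + \<psi> x) x\<bar>) < (1 / 2) ^ k \<and>
      (\<forall>t>0. t * measure unit_leb (big t \<psi>) \<le> K' * b k) \<and>
      ae_recovered U W \<and> measure unit_leb (bad N ((1 / 2) ^ k) W) < (1 / 2) ^ k \<and> (k = 0 \<longrightarrow> W = \<phi> 0))"
    for k and st :: "nat \<times> (real \<Rightarrow> real) \<times> (real \<Rightarrow> real)"
  define Q where "Q k st st' \<longleftrightarrow> (case st of (N, \<psi>, W) \<Rightarrow> case st' of (N', \<psi>', W') \<Rightarrow>
      N < N' \<and> W' = (\<lambda>x. (W x + \<psi> x) + \<phi> (Suc k) x))"
    for k and st st' :: "nat \<times> (real \<Rightarrow> real) \<times> (real \<Rightarrow> real)"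
  \<comment> \<open>One extension step serves both the start, with \<open>W = \<phi> 0\<close>, and
    the recursion, where \<open>M\<close> is the previous threshold and makes \<open>N\<close>
    strictly increasing.\<close>
  have ext: "\<exists>N \<psi>. M < N \<and> P k (N, \<psi>, W)"
    if W: "ae_recovered U W" and "k = 0 \<longrightarrow> W = \<phi> 0" for k M W
  proof -
    have "AE x in unit_leb. (\<lambda>n. U n W x) \<longlonglongrightarrow> W x" and Wi: "integrable unit_leb W"
      using W by (auto simp: ae_recovered_def)
    then have "AE x in unit_leb. (\<lambda>n. U n W x - W x) \<longlonglongrightarrow> 0"
      by (simp add: Lim_null[symmetric])
    then have "\<forall>\<^sub>F N in sequentially. measure unit_leb (bad N ((1 / 2) ^ k) W) < (1 / 2) ^ k"
      unfolding bad_def using op_measurable[OF U Wi] Wi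
      by (intro unit_leb.eventually_tail_exceptional_set_small) auto
    then have "\<forall>\<^sub>F N in sequentially. measure unit_leb (bad N ((1 / 2) ^ k) W) < (1 / 2) ^ k \<and> M < N"
      using eventually_gt_at_top by (rule eventually_conj)
    then obtain N where N: "measure unit_leb (bad N ((1 / 2) ^ k) W) < (1 / 2) ^ k" "M < N"
      unfolding eventually_sequentially by blast
    moreover from corr[of "(1 / 2) ^ k" k N] obtain \<psi> where "ae_recovered U \<psi>" "\<forall>x. x \<notin> V \<longrightarrow> \<psi> x = 0"
      "(LINT x|unit_leb. \<bar>\<psi> x\<bar>) \<le> K * b k"
      "(\<Sum>n<N. LINT x|unit_leb. \<bar>U n (\<lambda>x. \<phi> k x + \<psi> x) x\<bar>) < (1 / 2) ^ k"
      "\<forall>t>0. t * measure unit_leb (big t \<psi>) \<le> K' * b k"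
      unfolding big_def by auto
    ultimately show ?thesis
      using that unfolding P_def by blast
  qed
  have "\<exists>st. P 0 st"
    using ext[OF phi[of 0], of 0 0] by blast
  moreover have "\<exists>st'. P (Suc k) st' \<and> Q k st st'" if "P k st" for k st
  proof -
    obtain N \<psi> W where st: "st = (N, \<psi>, W)" by (cases st)
    have "ae_recovered U (\<lambda>x. (W x + \<psi> x) + \<phi> (Suc k) x)"
      using that unfolding st P_def by (intro ae_recovered_add U phi) auto
    from ext[OF this, of "Suc k" N] show ?thesis
      unfolding st Q_def by auto
  qed
  ultimately obtain st where st: "\<And>k. P k (st k)" "\<And>k. Q k (st k) (st (Suc k))"
    using dependent_nat_choice[of P Q] by blast
  define N where "N k = fst (st k)" for k
  define \<psi> where "\<psi> k = fst (snd (st k))" for k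
  define W where "W k = snd (snd (st k))" for k
  define \<gamma> where "\<gamma> k x = \<phi> k x + \<psi> k x" for k x
  define S where "S m x = (\<Sum>i<m. \<gamma> i x)" for m x
  have st_eq: "st k = (N k, \<psi> k, W k)" for k
    by (simp add: N_def \<psi>_def W_def)
  have psi: "ae_recovered U (\<psi> k)" and psi_V: "\<And>x. x \<notin> V \<Longrightarrow> \<psi> k x = 0"
    and psi_b: "(LINT x|unit_leb. \<bar>\<psi> k x\<bar>) \<le> K * b k"
    and early: "(\<Sum>n<N k. LINT x|unit_leb. \<bar>U n (\<gamma> k) x\<bar>) < (1 / 2) ^ k"
    and psi_big: "\<And>t. t > 0 \<Longrightarrow> t * measure unit_leb (big t (\<psi> k)) \<le> K' * b k"
    and W: "ae_recovered U (W k)" and bad: "measure unit_leb (bad (N k) ((1 / 2) ^ k) (W k)) < (1 / 2) ^ k"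
    and W0: "W 0 = \<phi> 0" for k
    using st(1)[of k] st(1)[of 0] unfolding st_eq P_def \<gamma>_def by auto
  have N: "strict_mono N" and W_Suc: "\<And>k. W (Suc k) = (\<lambda>x. (W k x + \<psi> k x) + \<phi> (Suc k) x)"
    using st(2) unfolding st_eq Q_def by (auto simp: strict_mono_Suc_iff)
  have W_S: "W k x = S k x + \<phi> k x" for k x
    by (induction k) (auto simp: W0 W_Suc S_def \<gamma>_def)
  have S_W: "S (Suc k) = (\<lambda>x. W k x + \<psi> k x)" for k
    by (auto simp: W_S S_def \<gamma>_def)
  have S_Suc: "S (Suc k) = (\<lambda>x. S k x + \<gamma> k x)" for k
    by (auto simp: S_def)
  have phi_int: "integrable unit_leb (\<phi> k)" and psi_int: "integrable unit_leb (\<psi> k)"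
    and W_int: "integrable unit_leb (W k)" for k
    using phi psi W by (auto simp: ae_recovered_def)
  have gam_int: "integrable unit_leb (\<gamma> k)" for k
    unfolding \<gamma>_def using phi_int psi_int by auto
  have S_int: "integrable unit_leb (S m)" for m
    unfolding S_def using gam_int by auto
  have phi_sum: "summable (\<lambda>k. LINT x|unit_leb. \<bar>\<phi> k x\<bar>)"
    by (rule summable_comparison_test'[OF b, of 0]) (use phi_b in auto)
  have psi_sum: "summable (\<lambda>k. LINT x|unit_leb. \<bar>\<psi> k x\<bar>)"
    by (rule summable_comparison_test'[OF summable_mult[OF b, of K], of 0]) (use psi_b in auto)
  have gam_sum: "summable (\<lambda>k. LINT x|unit_leb. \<bar>\<gamma> k x\<bar>)"
  proof (rule summable_comparison_test'[OF summable_add[OF phi_sum psi_sum], of 0])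
    fix k
    have "(LINT x|unit_leb. \<bar>\<gamma> k x\<bar>) \<le> (LINT x|unit_leb. \<bar>\<phi> k x\<bar> + \<bar>\<psi> k x\<bar>)"
      using phi_int psi_int gam_int by (intro integral_mono) (auto simp: \<gamma>_def)
    then show "norm (LINT x|unit_leb. \<bar>\<gamma> k x\<bar>) \<le> (LINT x|unit_leb. \<bar>\<phi> k x\<bar>) + (LINT x|unit_leb. \<bar>\<psi> k x\<bar>)"
      using phi_int psi_int by simp
  qed
  note gam_AE = AE_summable_of_integrals[OF gam_int gam_sum]
  \<comment> \<open>Off V the value is f itself, so that f and g agree there at every point and not
    just almost everywhere. Almost everywhere the definition still gives the sum of the series,
    because each \<open>\<psi> k\<close> vanishes off V.\<close>
  define g where "g x = (if x \<in> V then \<Sum>i. \<gamma> i x else f x)" for x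
  have g_AE: "AE x in unit_leb. (\<lambda>i. \<gamma> i x) sums g x"
    using gam_AE phi_f
  proof eventually_elim
    case (elim x)
    from elim(1) have "summable (\<lambda>i. \<gamma> i x)"
      by (rule summable_rabs_cancel)
    then have "(\<lambda>i. \<gamma> i x) sums g x" if "x \<in> V"
      using that by (simp add: g_def summable_sums)
    moreover have "(\<lambda>i. \<gamma> i x) sums g x" if "x \<notin> V"
      using elim(2) psi_V[OF that] that by (simp add: \<gamma>_def g_def)
    ultimately show ?case
      by blast
  qed
  have gam_suminf: "integrable unit_leb (\<lambda>x. \<Sum>i. \<gamma> i x)"
    using gam_int gam_AE gam_sum by (intro integrable_suminf) auto
  have g_meas [measurable]: "g \<in> borel_measurable unit_leb"
  proof -
    have "{x \<in> space unit_leb. x \<in> V} = {0..<1} \<inter> V"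
      by (auto simp: space_restrict_space)
    then have "{x \<in> space unit_leb. x \<in> V} \<in> sets unit_leb"
      using sets.Int[OF _ V, of "{0..<1}"] by (simp add: sets_restrict_space_iff)
    then show ?thesis
      unfolding g_def by (intro measurable_If borel_measurable_integrable[OF gam_suminf]
        borel_measurable_integrable[OF f])
  qed
  have "AE x in unit_leb. (\<Sum>i. \<gamma> i x) = g x"
    using g_AE by eventually_elim (simp add: sums_iff)
  then have g_int: "integrable unit_leb g"
    using integrable_cong_AE_imp[OF gam_suminf g_meas] by (simp add: eq_commute)
  have gS: "(\<lambda>m. LINT x|unit_leb. \<bar>g x - S m x\<bar>) \<longlonglongrightarrow> 0"
  proof (rule dominated_L1_convergence)
    show "integrable unit_leb (\<lambda>x. \<Sum>i. \<bar>\<gamma> i x\<bar>)"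
      using gam_int gam_AE gam_sum by (intro integrable_suminf) auto
    show "AE x in unit_leb. (\<lambda>m. S m x) \<longlonglongrightarrow> g x"
      using g_AE by eventually_elim (simp add: sums_def S_def)
    show "AE x in unit_leb. \<bar>g x - S m x\<bar> \<le> (\<Sum>i. \<bar>\<gamma> i x\<bar>)" for m
      using g_AE gam_AE
    proof eventually_elim
      case (elim x)
      have "g x - S m x = (\<Sum>i. \<gamma> (i + m) x)"
        using elim(1) suminf_minus_initial_segment[of "\<lambda>i. \<gamma> i x" m] by (simp add: sums_iff S_def)
      also have "\<bar>\<dots>\<bar> \<le> (\<Sum>i. \<bar>\<gamma> (i + m) x\<bar>)"
        using elim(2) by (intro summable_rabs) (subst summable_iff_shift[of "\<lambda>i. \<bar>\<gamma> i x\<bar>"])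
      also have "\<dots> \<le> (\<Sum>i. \<bar>\<gamma> i x\<bar>)"
        using suminf_split_initial_segment[OF elim(2), of m] by (simp add: sum_nonneg)
      finally show ?case .
    qed
  qed (use S_int in auto)
  have "\<forall>n. \<exists>C. \<forall>h. integrable unit_leb h \<longrightarrow>
      (AE x in unit_leb. \<bar>U n h x\<bar> \<le> C * (LINT x|unit_leb. \<bar>h x\<bar>))"
    by (rule allI) (rule op_bound[OF U])
  from choice[OF this] obtain C where C: "\<And>n h. integrable unit_leb h \<Longrightarrow>
      AE x in unit_leb. \<bar>U n h x\<bar> \<le> C n * (LINT x|unit_leb. \<bar>h x\<bar>)"
    by blast
  \<comment> \<open>\<open>C n\<close> does not depend on \<open>m\<close>, so for each n the L^1
    convergence of \<open>S m\<close> to \<open>g\<close> forces convergence at x; the exceptional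
    sets over all pairs form one null set.\<close>
  have "AE x in unit_leb. \<forall>n m. \<bar>U n (S m) x - U n g x\<bar> \<le> C n * (LINT x|unit_leb. \<bar>g x - S m x\<bar>)"
    unfolding AE_all_countable
  proof (intro allI)
    fix n m
    show "AE x in unit_leb. \<bar>U n (S m) x - U n g x\<bar> \<le> C n * (LINT x|unit_leb. \<bar>g x - S m x\<bar>)"
      using C[OF Bochner_Integration.integrable_diff[OF g_int S_int[of m]], of n]
        op_diff[OF U g_int S_int[of m], of n]
      by eventually_elim simp
  qed
  then have lim_AE: "AE x in unit_leb. \<forall>n. (\<lambda>m. U n (S m) x) \<longlonglongrightarrow> U n g x"
  proof eventually_elim
    case (elim x)
    show ?case
    proof
      fix n
      have "(\<lambda>m. C n * (LINT x|unit_leb. \<bar>g x - S m x\<bar>)) \<longlonglongrightarrow> 0"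
        using tendsto_mult_right_zero[OF gS] by simp
      then have "(\<lambda>m. U n (S m) x - U n g x) \<longlonglongrightarrow> 0"
        by (rule Lim_null_comparison[rotated]) (use elim in simp)
      then show "(\<lambda>m. U n (S m) x) \<longlonglongrightarrow> U n g x"
        by (rule Lim_null[THEN iffD2])
    qed
  qed
  \<comment> \<open>The sum \<open>S (Suc k)\<close> is split in two ways: as
    \<open>S k + \<gamma> k\<close> for the tail estimate, and as \<open>W k + \<psi> k\<close> to
    isolate the term under the weak-type bound.\<close>
  have add1_AE: "AE x in unit_leb. \<forall>n k. U n (S (Suc k)) x = U n (S k) x + U n (\<gamma> k) x"
    unfolding AE_all_countable S_Suc using op_add[OF U S_int gam_int] by blast
  have add2_AE: "AE x in unit_leb. \<forall>n k. U n (S (Suc k)) x = U n (W k) x + U n (\<psi> k) x"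
    unfolding AE_all_countable S_W using op_add[OF U W_int psi_int] by blast
  have UW [measurable]: "U n (W k) \<in> borel_measurable unit_leb" "W k \<in> borel_measurable unit_leb"
    "U n (\<psi> k) \<in> borel_measurable unit_leb" for n k
    using op_measurable[OF U] W_int psi_int by auto
  have "AE x in unit_leb. \<forall>\<^sub>F k in sequentially. x \<notin> bad (N k) ((1 / 2) ^ k) (W k)"
  proof (rule unit_leb.AE_eventually_not_in)
    show "bad (N k) ((1 / 2) ^ k) (W k) \<in> sets unit_leb" for k
      unfolding bad_def by measurable
    show "measure unit_leb (bad (N k) ((1 / 2) ^ k) (W k)) \<le> (1 / 2) ^ k" for k
      using bad[of k] by simp
  qed simp
  then have late_AE: "AE x in unit_leb. \<forall>\<^sub>F k in sequentially. \<forall>n\<ge>N k. \<bar>U n (W k) x - W k x\<bar> \<le> (1 / 2) ^ k"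
    using AE_space by eventually_elim (auto elim!: eventually_mono simp: bad_def not_less)
  \<comment> \<open>The thresholds 1/(j+1) replace all positive numbers so that countably many uses
    of Borel--Cantelli suffice. For fixed j the weak-type bound costs the constant factor j+1, which
    leaves the series summable.\<close>
  have "AE x in unit_leb. \<forall>j. \<forall>\<^sub>F k in sequentially. x \<notin> big (1 / real (Suc j)) (\<psi> k)"
    unfolding AE_all_countable
  proof
    fix j
    show "AE x in unit_leb. \<forall>\<^sub>F k in sequentially. x \<notin> big (1 / real (Suc j)) (\<psi> k)"
    proof (rule unit_leb.AE_eventually_not_in)
      show "big (1 / real (Suc j)) (\<psi> k) \<in> sets unit_leb" for k
        unfolding big_def by measurable
      show "measure unit_leb (big (1 / real (Suc j)) (\<psi> k)) \<le> real (Suc j) * (K' * b k)" for k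
        using psi_big[of "1 / real (Suc j)" k] by (simp add: field_simps)
      show "summable (\<lambda>k. real (Suc j) * (K' * b k))"
        by (intro summable_mult b)
    qed
  qed
  then have mid_AE: "AE x in unit_leb. \<forall>j. \<forall>\<^sub>F k in sequentially. \<forall>n. \<bar>U n (\<psi> k) x\<bar> \<le> 1 / real (Suc j)"
    using AE_space
  proof eventually_elim
    case (elim x)
    show ?case
    proof
      fix j
      show "\<forall>\<^sub>F k in sequentially. \<forall>n. \<bar>U n (\<psi> k) x\<bar> \<le> 1 / real (Suc j)"
        using elim(1)[rule_format, of j] elim(2) by (auto elim!: eventually_mono simp: big_def not_less)
    qed
  qed
  \<comment> \<open>Summing over all n < \<open>N k\<close> gives one majorant for every early
    contribution of \<open>\<gamma> k\<close>; its integral is below 2^{-k}.\<close>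
  define h where "h k x = (\<Sum>n<N k. \<bar>U n (\<gamma> k) x\<bar>)" for k x
  have h_int: "integrable unit_leb (h k)" for k
    unfolding h_def using op_integrable[OF U gam_int] by auto
  have h_AE: "AE x in unit_leb. summable (\<lambda>k. \<bar>h k x\<bar>)"
  proof (rule AE_summable_of_integrals[OF h_int])
    show "summable (\<lambda>k. LINT x|unit_leb. \<bar>h k x\<bar>)"
    proof (rule summable_comparison_test'[OF summable_geometric[of "1/2::real"], of 0])
      fix k
      have "(LINT x|unit_leb. \<bar>h k x\<bar>) = (LINT x|unit_leb. h k x)"
        by (simp add: h_def sum_nonneg)
      also have "\<dots> = (\<Sum>n<N k. LINT x|unit_leb. \<bar>U n (\<gamma> k) x\<bar>)"
        unfolding h_def using op_integrable[OF U gam_int] by (intro Bochner_Integration.integral_sum) auto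
      finally show "norm (LINT x|unit_leb. \<bar>h k x\<bar>) \<le> (1 / 2) ^ k"
        using early[of k] by (simp add: abs_of_nonneg[OF sum_nonneg])
    qed simp
  qed
  have "AE x in unit_leb. (\<lambda>n. U n g x) \<longlonglongrightarrow> g x"
    using lim_AE add1_AE add2_AE late_AE mid_AE h_AE g_AE AE_summable_of_integrals[OF phi_int phi_sum]
  proof eventually_elim
    case (elim x)
    have "(\<lambda>k. \<phi> k x) \<longlonglongrightarrow> 0"
      using summable_LIMSEQ_zero[OF elim(8)] by (simp add: tendsto_rabs_zero_iff)
    moreover have "(\<lambda>k. S k x) \<longlonglongrightarrow> g x"
      using elim(7) by (simp add: sums_def S_def)
    ultimately have W_lim: "(\<lambda>k. W k x) \<longlonglongrightarrow> g x"
      unfolding W_S using tendsto_add[of "\<lambda>k. S k x" "g x" _ "\<lambda>k. \<phi> k x" 0] by simp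
    have h_sum: "summable (\<lambda>k. h k x)"
      using elim(6) by (rule summable_rabs_cancel)
    have h_ge: "\<bar>U n (\<gamma> k) x\<bar> \<le> h k x" if "n < N k" for n k
      unfolding h_def using that by (intro member_le_sum[of n "{..<N k}" "\<lambda>n. \<bar>U n (\<gamma> k) x\<bar>"]) auto
    show ?case
      by (rule gliding_hump_pointwise[where N = N and u = "\<lambda>n m. U n (S m) x"
          and a = "\<lambda>n k. U n (\<gamma> k) x" and w = "\<lambda>n k. U n (W k) x" and q = "\<lambda>n k. U n (\<psi> k) x"
          and W = "\<lambda>k. W k x" and h = "\<lambda>k. h k x",
          OF N elim(1)[rule_format] elim(2)[rule_format] elim(3)[rule_format] elim(4)
            elim(5)[rule_format] h_sum h_ge W_lim])
  qed
  moreover have "{x\<in>{0..<1}. f x \<noteq> g x} \<subseteq> V"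
    by (auto simp: g_def split: if_splits)
  ultimately show ?thesis
    using g_int by blast
qed

subsection \<open>Correction of a single term\<close>

text \<open>Multiplication by the indicator of D moves onto the test function and keeps it in
  L^\<infinity>. Hence the localized functions \<open>a l * indicat_real (G l \<inter> D) x\<close>
  converge weakly to the indicator of D, and the two terms cancel in the limit.\<close>

lemma weakly_converges_localized:
  assumes G: "\<And>l. G l \<in> sets lebesgue" and D: "D \<in> sets lebesgue" "D \<subseteq> {0..<1}"
    and weak: "weakly_converges (\<lambda>l x. a l * indicat_real (G l) x) (indicat_real {0..<1})"
  shows "weakly_converges (\<lambda>l x. c * indicat_real D x + - (c * a l) * indicat_real (G l \<inter> D) x) (\<lambda>_. 0)"
proof -
  have GD: "G l \<inter> D \<in> sets lebesgue" for l
    using G D by (intro sets.Int)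
  have "(\<lambda>l. LINT x|unit_leb. (c * indicat_real D x + - (c * a l) * indicat_real (G l \<inter> D) x) * h x) \<longlonglongrightarrow> 0"
    if h: "h \<in> Linf" for h
  proof -
    have [measurable]: "h \<in> borel_measurable unit_leb"
      using h by (simp add: Linf_def)
    have ind: "(\<lambda>x. indicat_real A x * h x) \<in> Linf" "integrable unit_leb (\<lambda>x. indicat_real A x * h x)"
      if A: "A \<in> sets lebesgue" for A
    proof -
      have [measurable]: "indicat_real A \<in> borel_measurable unit_leb"
        using integrable_indicator_unit_leb[OF A] by auto
      have bd: "AE x in unit_leb. \<bar>indicat_real A x * h x\<bar> \<le> Linf_norm h"
        using Linf_bounded[OF h] by eventually_elim (auto simp: indicator_def)
      show "(\<lambda>x. indicat_real A x * h x) \<in> Linf"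
        by (rule bounded_in_Linf[OF _ bd]) measurable
      show "integrable unit_leb (\<lambda>x. indicat_real A x * h x)"
        using bd by (intro unit_leb.integrable_const_bound[where B = "Linf_norm h"]) auto
    qed
    have "(\<lambda>l. LINT x|unit_leb. a l * indicat_real (G l) x * (indicat_real D x * h x))
        \<longlonglongrightarrow> (LINT x|unit_leb. indicat_real {0..<1} x * (indicat_real D x * h x))"
      using weak ind(1)[OF D(1)] by (simp add: weakly_converges_def)
    moreover have "(LINT x|unit_leb. indicat_real {0..<1} x * (indicat_real D x * h x))
        = (LINT x|unit_leb. indicat_real D x * h x)"
      by (intro Bochner_Integration.integral_cong) (auto simp: indicator_def space_restrict_space)
    moreover have "(LINT x|unit_leb. a l * indicat_real (G l) x * (indicat_real D x * h x))
        = (LINT x|unit_leb. a l * (indicat_real (G l \<inter> D) x * h x))" for l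
      by (intro Bochner_Integration.integral_cong) (auto simp: indicator_def)
    ultimately have "(\<lambda>l. LINT x|unit_leb. a l * (indicat_real (G l \<inter> D) x * h x))
        \<longlonglongrightarrow> (LINT x|unit_leb. indicat_real D x * h x)"
      by simp
    then have "(\<lambda>l. c * (LINT x|unit_leb. indicat_real D x * h x)
          - c * (LINT x|unit_leb. a l * (indicat_real (G l \<inter> D) x * h x)))
        \<longlonglongrightarrow> c * (LINT x|unit_leb. indicat_real D x * h x) - c * (LINT x|unit_leb. indicat_real D x * h x)"
      by (intro tendsto_intros)
    moreover have "(LINT x|unit_leb. (c * indicat_real D x + - (c * a l) * indicat_real (G l \<inter> D) x) * h x) =
        c * (LINT x|unit_leb. indicat_real D x * h x) - c * (LINT x|unit_leb. a l * (indicat_real (G l \<inter> D) x * h x))" for l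
    proof -
      have "(LINT x|unit_leb. (c * indicat_real D x + - (c * a l) * indicat_real (G l \<inter> D) x) * h x) =
        (LINT x|unit_leb. c * (indicat_real D x * h x) - c * (a l * (indicat_real (G l \<inter> D) x * h x)))"
        by (intro Bochner_Integration.integral_cong) (auto simp: algebra_simps)
      also have "\<dots> = (LINT x|unit_leb. c * (indicat_real D x * h x))
          - (LINT x|unit_leb. c * (a l * (indicat_real (G l \<inter> D) x * h x)))"
        by (intro Bochner_Integration.integral_diff integrable_mult_right ind D GD)
      finally show ?thesis
        by simp
    qed
    ultimately show ?thesis
      by simp
  qed
  then show ?thesis
    unfolding weakly_converges_def Lp_1_iff
    by (auto intro!: Bochner_Integration.integrable_add integrable_mult_right integrable_indicator_unit_leb D GD)
qed

text \<open>All demands are met by the scaled indicator of \<open>G l \<inter> D\<close> with l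
  large: compactness makes finitely many images small, weak convergence bounds the L^1 norm, and
  homogeneity transfers the weak-type estimate, whose constant is the same for all l.\<close>

lemma correction_exists:
  assumes U: "\<And>n. bounded_operator_into Linf Linf_norm (U n)" and cpt: "property_A U"
    and intv: "\<And>J. unit_interval J \<Longrightarrow> ae_recovered U (indicat_real J)"
    and G: "\<And>l. finite_interval_set (G l)" "\<And>l. G l \<subseteq> V" "\<And>l. 0 < measure lebesgue (G l)"
    and weak: "weakly_converges (\<lambda>l x. inverse (measure lebesgue (G l)) * indicat_real (G l) x)
          (indicat_real {0..<1})"
    and D: "unit_interval D"
    and weak_type: "\<And>t l. t > 0 \<Longrightarrow>
      t * measure lebesgue {x\<in>{0..<1}. maximal_fn U (indicat_real (G l \<inter> D)) x > ereal t}
        \<le> \<beta> * measure lebesgue (G l \<inter> D)"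
    and "\<beta> > 0" "e > 0"
  shows "\<exists>\<psi>. ae_recovered U \<psi> \<and> (\<forall>x. x \<notin> V \<longrightarrow> \<psi> x = 0) \<and>
        (LINT x|unit_leb. \<bar>\<psi> x\<bar>) \<le> 2 * (\<bar>c\<bar> * measure lebesgue D) \<and>
        (\<Sum>n<N. LINT x|unit_leb. \<bar>U n (\<lambda>x. c * indicat_real D x + \<psi> x) x\<bar>) < e \<and>
        (\<forall>t>0. t * measure unit_leb {x\<in>space unit_leb. \<exists>n. \<bar>U n \<psi> x\<bar> > t} \<le> (2 * \<beta>) * (\<bar>c\<bar> * measure lebesgue D))"
proof -
  define a where "a l = inverse (measure lebesgue (G l))" for l
  have a_pos: "a l > 0" for l
    using G(3) by (simp add: a_def)
  have Gm: "G l \<in> sets lebesgue" "G l \<subseteq> {0..<1}" for l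
  proof -
    obtain F where F: "finite F" "\<forall>J\<in>F. unit_interval J" "G l = \<Union>F"
      using G(1)[of l] by (auto simp: finite_interval_set_def)
    then show "G l \<in> sets lebesgue" "G l \<subseteq> {0..<1}"
      using unit_interval_measurable by (auto intro!: sets.finite_Union)
  qed
  have Dm: "D \<in> sets lebesgue" "D \<subseteq> {0..<1}"
    using unit_interval_measurable[OF D] by auto
  have GD: "G l \<inter> D \<in> sets lebesgue" "G l \<inter> D \<subseteq> {0..<1}" for l
    using Gm Dm by auto
  have D_pos: "measure lebesgue D > 0"
    using D by (auto simp: unit_interval_def)
  define \<psi> where "\<psi> l x = - (c * a l) * indicat_real (G l \<inter> D) x" for l x
  have weak0: "weakly_converges (\<lambda>l x. c * indicat_real D x + \<psi> l x) (\<lambda>_. 0)"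
    unfolding \<psi>_def using weak by (intro weakly_converges_localized Gm Dm) (simp add: a_def)
  have "(\<lambda>l. \<Sum>n<N. LINT x|unit_leb. \<bar>U n (\<lambda>x. c * indicat_real D x + \<psi> l x) x\<bar>) \<longlonglongrightarrow> (\<Sum>n<N. 0)"
    using cpt by (intro tendsto_sum compact_operator_null[OF U _ weak0]) (simp add: property_A_def)
  then have ev1: "\<forall>\<^sub>F l in sequentially. (\<Sum>n<N. LINT x|unit_leb. \<bar>U n (\<lambda>x. c * indicat_real D x + \<psi> l x) x\<bar>) < e"
    using \<open>e > 0\<close> by (intro order_tendstoD(2)) auto
  \<comment> \<open>Testing the weak convergence against the indicator of D shows that
    \<open>a l * measure lebesgue (G l \<inter> D)\<close> tends to the measure of D.\<close>
  have "indicat_real D \<in> Linf"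
    using integrable_indicator_unit_leb[OF Dm(1)]
    by (intro bounded_in_Linf[where B = 1]) (auto simp: indicator_def)
  then have "(\<lambda>l. LINT x|unit_leb. a l * indicat_real (G l) x * indicat_real D x)
      \<longlonglongrightarrow> (LINT x|unit_leb. indicat_real {0..<1} x * indicat_real D x)"
    using weak by (simp add: weakly_converges_def a_def)
  moreover have "(LINT x|unit_leb. indicat_real {0..<1} x * indicat_real D x) = (LINT x|unit_leb. indicat_real D x)"
    by (intro Bochner_Integration.integral_cong) (auto simp: indicator_def space_restrict_space)
  moreover have "(LINT x|unit_leb. a l * indicat_real (G l) x * indicat_real D x)
      = (LINT x|unit_leb. a l * indicat_real (G l \<inter> D) x)" for l
    by (intro Bochner_Integration.integral_cong) (auto simp: indicator_def)
  ultimately have "(\<lambda>l. a l * measure lebesgue (G l \<inter> D)) \<longlonglongrightarrow> measure lebesgue D"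
    using integral_indicator_unit[OF Dm(2,1)] integral_indicator_unit[OF GD(2,1)]
    by (simp only: integral_mult_right_zero)
  \<comment> \<open>Positivity of |D| puts 2|D| strictly above the limit; both factors 2 in the
    conclusion come from here.\<close>
  then have ev2: "\<forall>\<^sub>F l in sequentially. a l * measure lebesgue (G l \<inter> D) < 2 * measure lebesgue D"
    using D_pos by (intro order_tendstoD(2)) auto
  obtain l where l: "(\<Sum>n<N. LINT x|unit_leb. \<bar>U n (\<lambda>x. c * indicat_real D x + \<psi> l x) x\<bar>) < e"
    "a l * measure lebesgue (G l \<inter> D) < 2 * measure lebesgue D"
    using eventually_conj[OF ev1 ev2] unfolding eventually_sequentially by blast
  have rec: "ae_recovered U (indicat_real (G l \<inter> D))"
    by (rule ae_recovered_finite_interval_set[OF U intv G(1) D])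
  have int: "integrable unit_leb (indicat_real (G l \<inter> D))"
    by (rule integrable_indicator_unit_leb[OF GD(1)])
  have small: "\<bar>c\<bar> * (a l * measure lebesgue (G l \<inter> D)) \<le> 2 * (\<bar>c\<bar> * measure lebesgue D)"
    using l(2) mult_left_mono[of "a l * measure lebesgue (G l \<inter> D)" "2 * measure lebesgue D" "\<bar>c\<bar>"] by simp
  have "(LINT x|unit_leb. \<bar>\<psi> l x\<bar>) = (LINT x|unit_leb. (\<bar>c\<bar> * a l) * indicat_real (G l \<inter> D) x)"
    using a_pos[of l] by (intro Bochner_Integration.integral_cong) (auto simp: \<psi>_def abs_mult)
  also have "\<dots> = \<bar>c\<bar> * a l * measure lebesgue (G l \<inter> D)"
    using integral_indicator_unit[OF GD(2,1)] by (simp only: integral_mult_right_zero)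
  finally have norm: "(LINT x|unit_leb. \<bar>\<psi> l x\<bar>) \<le> 2 * (\<bar>c\<bar> * measure lebesgue D)"
    using small by (simp add: mult.assoc)
  have wt: "t * measure unit_leb {x\<in>space unit_leb. \<exists>n. \<bar>U n (\<psi> l) x\<bar> > t} \<le> (2 * \<beta>) * (\<bar>c\<bar> * measure lebesgue D)"
    if t: "t > 0" for t
  proof -
    have [measurable]: "U n (indicat_real (G l \<inter> D)) \<in> borel_measurable unit_leb" "U n (\<psi> l) \<in> borel_measurable unit_leb" for n
      using op_measurable[OF U] int unfolding \<psi>_def by auto
    have eq: "AE x in unit_leb. \<forall>n. U n (\<psi> l) x = - (c * a l) * U n (indicat_real (G l \<inter> D)) x"
      unfolding AE_all_countable \<psi>_def using op_scale[OF U int] by blast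
    show ?thesis
    \<comment> \<open>The rescaled threshold below divides by \<open>\<bar>c\<bar>\<close>; for
      \<open>c = 0\<close> every \<open>U n (\<psi> l)\<close> vanishes almost everywhere and the
      level set is null.\<close>
    proof (cases "c = 0")
      case True
      have "measure unit_leb {x\<in>space unit_leb. \<exists>n. \<bar>U n (\<psi> l) x\<bar> > t} = measure unit_leb {}"
      proof (rule measure_eq_AE)
        show "AE x in unit_leb. x \<in> {x\<in>space unit_leb. \<exists>n. \<bar>U n (\<psi> l) x\<bar> > t} \<longleftrightarrow> x \<in> {}"
          using eq by eventually_elim (use True t in simp)
      qed measurable
      then show ?thesis
        using True by simp
    next
      case False
      \<comment> \<open>By homogeneity the level t for \<open>\<psi> l\<close> corresponds to the
        level r for the unscaled indicator.\<close>
      define r where "r = t / (\<bar>c\<bar> * a l)"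
      have r: "r > 0"
        using False t a_pos[of l] by (simp add: r_def)
      have "measure unit_leb {x\<in>space unit_leb. \<exists>n. \<bar>U n (\<psi> l) x\<bar> > t}
          = measure unit_leb {x\<in>space unit_leb. \<exists>n. \<bar>U n (indicat_real (G l \<inter> D)) x\<bar> > r}"
      proof (rule measure_eq_AE)
        have iff: "t < \<bar>- (c * a l) * y\<bar> \<longleftrightarrow> r < \<bar>y\<bar>" for y
          using False a_pos[of l] by (simp add: r_def abs_mult field_simps)
        show "AE x in unit_leb. x \<in> {x\<in>space unit_leb. \<exists>n. \<bar>U n (\<psi> l) x\<bar> > t} \<longleftrightarrow>
            x \<in> {x\<in>space unit_leb. \<exists>n. \<bar>U n (indicat_real (G l \<inter> D)) x\<bar> > r}"
          using eq by eventually_elim (simp only: iff mem_Collect_eq)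
      qed measurable
      also have "\<dots> = measure lebesgue {x\<in>{0..<1}. maximal_fn U (indicat_real (G l \<inter> D)) x > ereal r}"
      proof -
        have "{x\<in>space unit_leb. \<exists>n. \<bar>U n (indicat_real (G l \<inter> D)) x\<bar> > r} =
            {x\<in>{0..<1}. maximal_fn U (indicat_real (G l \<inter> D)) x > ereal r}"
          by (auto simp: maximal_fn_def less_SUP_iff space_restrict_space)
        moreover have "{x\<in>space unit_leb. \<exists>n. \<bar>U n (indicat_real (G l \<inter> D)) x\<bar> > r} \<in> sets unit_leb"
          by measurable
        ultimately show ?thesis
          by (subst measure_restrict_space) (auto simp: sets_restrict_space_iff)
      qed
      finally have eq_max: "measure unit_leb {x\<in>space unit_leb. \<exists>n. \<bar>U n (\<psi> l) x\<bar> > t} =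
          measure lebesgue {x\<in>{0..<1}. maximal_fn U (indicat_real (G l \<inter> D)) x > ereal r}" .
      have "t * y = \<bar>c\<bar> * a l * (r * y)" for y
        using False a_pos[of l] by (simp add: r_def)
      then have "t * measure unit_leb {x\<in>space unit_leb. \<exists>n. \<bar>U n (\<psi> l) x\<bar> > t} = \<bar>c\<bar> * a l *
          (r * measure lebesgue {x\<in>{0..<1}. maximal_fn U (indicat_real (G l \<inter> D)) x > ereal r})"
        unfolding eq_max .
      also have "\<dots> \<le> \<bar>c\<bar> * a l * (\<beta> * measure lebesgue (G l \<inter> D))"
        using weak_type[OF r, of l] a_pos[of l] by (intro mult_left_mono) auto
      also have "\<dots> = \<beta> * (\<bar>c\<bar> * (a l * measure lebesgue (G l \<inter> D)))"
        by (simp only: ac_simps)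
      also have "\<dots> \<le> \<beta> * (2 * (\<bar>c\<bar> * measure lebesgue D))"
        using small \<open>\<beta> > 0\<close> by (intro mult_left_mono) auto
      finally show ?thesis
        by (simp only: ac_simps)
    qed
  qed
  have "ae_recovered U (\<psi> l)"
    unfolding \<psi>_def by (rule ae_recovered_scale[OF U rec])
  moreover have "\<forall>x. x \<notin> V \<longrightarrow> \<psi> l x = 0"
    using G(2)[of l] by (auto simp: \<psi>_def indicator_def)
  ultimately show ?thesis
    using norm l(1) wt by blast
qed

section \<open>Combination of the expansion, the corrections and the gliding hump\<close>

theorem theorem2:
  fixes p :: real
    and U :: "nat \<Rightarrow> (real \<Rightarrow> real) \<Rightarrow> real \<Rightarrow> real"
    and V :: "real set"
  assumes "1 < p"
    and "\<And>n. bounded_operator_into Linf Linf_norm (U n)"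
    and "property_A U"
    and "property_B p U"
    and "property_C U"
    and "property_Dstar U"
    and "dense_open V"
  shows "\<forall>f\<in>Lp 1. \<exists>g\<in>Lp 1. {x\<in>{0..<1}. f x \<noteq> g x} \<subseteq> V \<and>
           (AE x in unit_leb. (\<lambda>n. U n g x) \<longlonglongrightarrow> g x)"
proof
  fix f assume "f \<in> Lp 1"
  then have f: "integrable unit_leb f"
    by (simp add: Lp_1_iff)
  note U = assms(2)
  obtain T where "open T" "V = {0..<1} \<inter> T"
    using \<open>dense_open V\<close> by (auto simp: dense_open_def openin_open)
  then have V: "V \<in> sets lebesgue"
    by auto
  obtain \<beta> where \<beta>: "\<beta> > 0" and Dstar: "\<And>\<epsilon> V. 0 < \<epsilon> \<and> \<epsilon> < 1 \<and> dense_open V \<Longrightarrow>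
      (\<exists>G :: nat \<Rightarrow> real set.
        (\<forall>l. finite_interval_set (G l) \<and> G l \<subseteq> V \<and>
             0 < measure lebesgue (G l) \<and> measure lebesgue (G l) \<le> \<epsilon>) \<and>
        weakly_converges (\<lambda>l x. inverse (measure lebesgue (G l)) * indicat_real (G l) x)
          (indicat_real {0..<1}) \<and>
        (\<exists>\<I>. interval_basis \<I> \<and>
          (\<forall>\<Delta>\<in>\<I>. \<forall>t>0. \<forall>l.
            t * measure lebesgue {x\<in>{0..<1}. maximal_fn U (indicat_real (G l \<inter> \<Delta>)) x > ereal t}
              \<le> \<beta> * measure lebesgue (G l \<inter> \<Delta>))))"
    using \<open>property_Dstar U\<close> unfolding property_Dstar_def by blast
  \<comment> \<open>The basis is fixed before f is expanded, because the maximal estimate for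
    \<open>G\<close> refers to its members.\<close>
  obtain G I where G: "\<And>l. finite_interval_set (G l)" "\<And>l. G l \<subseteq> V" "\<And>l. 0 < measure lebesgue (G l)"
    and weak: "weakly_converges (\<lambda>l x. inverse (measure lebesgue (G l)) * indicat_real (G l) x)
          (indicat_real {0..<1})"
    and I: "interval_basis I"
    and wt: "\<And>\<Delta> t l. \<Delta> \<in> I \<Longrightarrow> t > 0 \<Longrightarrow>
            t * measure lebesgue {x\<in>{0..<1}. maximal_fn U (indicat_real (G l \<inter> \<Delta>)) x > ereal t}
              \<le> \<beta> * measure lebesgue (G l \<inter> \<Delta>)"
  proof -
    \<comment> \<open>The value 1/2 is an arbitrary choice of \<epsilon> in (0,1).\<close>
    have "0 < (1 / 2 :: real) \<and> (1 / 2 :: real) < 1 \<and> dense_open V"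
      using \<open>dense_open V\<close> by simp
    from Dstar[OF this] show ?thesis
      using that by blast
  qed
  obtain c D where D: "\<And>k. D k \<in> I" and sm: "summable (\<lambda>k. \<bar>c k\<bar> * measure lebesgue (D k))"
    and sums: "AE x in unit_leb. (\<lambda>k. c k * indicat_real (D k) x) sums f x"
    by (rule basis_series_expansion[OF f I]) (rule that)
  have Du: "unit_interval (D k)" for k
    using D I by (auto simp: interval_basis_def)
  have intv: "ae_recovered U (indicat_real J)" if "unit_interval J" for J
    using assms that by (intro ae_recovered_interval)
  have "\<exists>g. integrable unit_leb g \<and> {x\<in>{0..<1}. f x \<noteq> g x} \<subseteq> V \<and>
    (AE x in unit_leb. (\<lambda>n. U n g x) \<longlonglongrightarrow> g x)"
  \<comment> \<open>Here \<open>b k\<close> is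
    \<open>\<bar>c k\<bar> * measure lebesgue (D k)\<close>, the L^1 norm of the k-th term; the
    constants \<open>K\<close> and \<open>K'\<close> become 2 and 2\<beta>, both independent of
    k.\<close>
  proof (rule gliding_hump[OF U f V _ _ sm sums])
    show "ae_recovered U (\<lambda>x. c k * indicat_real (D k) x)" for k
      by (rule ae_recovered_scale[OF U intv[OF Du]])
    show "(LINT x|unit_leb. \<bar>c k * indicat_real (D k) x\<bar>) \<le> \<bar>c k\<bar> * measure lebesgue (D k)" for k
    proof -
      have "(LINT x|unit_leb. \<bar>c k * indicat_real (D k) x\<bar>) = (LINT x|unit_leb. \<bar>c k\<bar> * indicat_real (D k) x)"
        by (simp add: abs_mult)
      also have "\<dots> = \<bar>c k\<bar> * measure lebesgue (D k)"
        using unit_interval_measurable[OF Du[of k]] integral_indicator_unit[of "D k"]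
        by (simp only: integral_mult_right_zero)
      finally show ?thesis by simp
    qed
    show "\<exists>\<psi>. ae_recovered U \<psi> \<and> (\<forall>x. x \<notin> V \<longrightarrow> \<psi> x = 0) \<and>
        (LINT x|unit_leb. \<bar>\<psi> x\<bar>) \<le> 2 * (\<bar>c k\<bar> * measure lebesgue (D k)) \<and>
        (\<Sum>n<N. LINT x|unit_leb. \<bar>U n (\<lambda>x. c k * indicat_real (D k) x + \<psi> x) x\<bar>) < e \<and>
        (\<forall>t>0. t * measure unit_leb {x\<in>space unit_leb. \<exists>n. \<bar>U n \<psi> x\<bar> > t}
          \<le> (2 * \<beta>) * (\<bar>c k\<bar> * measure lebesgue (D k)))" if "e > 0" for k N e
      by (rule correction_exists[OF U assms(3) intv G weak Du wt[OF D] \<beta> that])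
  qed
  then show "\<exists>g\<in>Lp 1. {x\<in>{0..<1}. f x \<noteq> g x} \<subseteq> V \<and> (AE x in unit_leb. (\<lambda>n. U n g x) \<longlonglongrightarrow> g x)"
    by (auto simp: Lp_1_iff)
qed

end
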